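(* There is an absolute constant $C>0$ such that the following holds. Fix $d,k\in\mathbb N$. Let $A=gg^\top$ with $g\in\mathbb R^{d^k}$ having iid standard normal entries, and let $x=x_1\otimes\cdots\otimes x_k$ with $x_1,\dots,x_k\in\mathbb C^d$ independent (and independent of $g$), each a complex Rademacher or complex Gaussian vector. Then (i) with probability at least $3/4$ over $g$, $\operatorname{Var}[x^*Ax\mid g]\le C(1+\tfrac1d)^k(\operatorname{tr}(A))^2$; and (ii) for every $\varepsilon\in(0,1)$ and every $\ell\ge C\varepsilon^{-2}(1+\tfrac1d)^k$, with probability at least $2/3$ the complex Kronecker–Hutchinson estimator satisfies $|H_\ell(A)-\operatorname{tr}(A)|\le\varepsilon\operatorname{tr}(A)$.
   Context: A complex Rademacher (resp. complex Gaussian) vector is $\frac1{\sqrt2}r+\frac{\mathrm i}{\sqrt2}m$ with $r,m\in\mathbb R^d$ independent vectors of iid Rademacher ($\pm1$ uniform) (resp. standard normal) entries. $x^*$ is the conjugate transpose and $\operatorname{Var}[X]=\mathbb E|X-\mathbb EX|^2$. $H_\ell(A)=\frac1\ell\sum_{j=1}^\ell (x^{(j)})^*Ax^{(j)}$ with $x^{(j)}$ iid copies of $x$. *)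

theory Defs
  imports "HOL-Probability.Probability"
begin

definition rademacher_real :: "real measure" where
  "rademacher_real = distr (measure_pmf (pmf_of_set {-1, 1})) borel (\<lambda>x. x)"

definition gaussian_real :: "real measure" where
  "gaussian_real = density lborel std_normal_density"

definition complex_entry :: "real measure \<Rightarrow> complex measure" where
  "complex_entry \<mu> = distr (\<mu> \<Otimes>\<^sub>M \<mu>) borel
     (\<lambda>(r, m). complex_of_real (r / sqrt 2) + \<i> * complex_of_real (m / sqrt 2))"

definition entry_law :: "bool \<Rightarrow> complex measure" where
  "entry_law rad = (if rad then complex_entry rademacher_real else complex_entry gaussian_real)"

text \<open>Index set of R^(d^k): multi-indices (i_1,...,i_k) with i_j < d.\<close>
definition tidx :: "nat \<Rightarrow> nat \<Rightarrow> (nat \<Rightarrow> nat) set" where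
  "tidx d k = {0..<k} \<rightarrow>\<^sub>E {0..<d}"

definition g_law :: "nat \<Rightarrow> nat \<Rightarrow> ((nat \<Rightarrow> nat) \<Rightarrow> real) measure" where
  "g_law d k = PiM (tidx d k) (\<lambda>_. gaussian_real)"

text \<open>Law of the factor vectors x_1..x_k: X (j,i) is entry i of x_{j+1}, all independent.\<close>
definition factors_law :: "nat \<Rightarrow> nat \<Rightarrow> (nat \<Rightarrow> bool) \<Rightarrow> (nat \<times> nat \<Rightarrow> complex) measure" where
  "factors_law d k t = PiM ({0..<k} \<times> {0..<d}) (\<lambda>(j, i). entry_law (t j))"

text \<open>Law of l iid copies: Y (s,j,i) is entry i of factor j of the s-th copy.\<close>
definition copies_law :: "nat \<Rightarrow> nat \<Rightarrow> (nat \<Rightarrow> bool) \<Rightarrow> nat \<Rightarrow> (nat \<times> nat \<times> nat \<Rightarrow> complex) measure" where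
  "copies_law d k t l = PiM ({0..<l} \<times> {0..<k} \<times> {0..<d}) (\<lambda>(s, j, i). entry_law (t j))"

definition kron :: "nat \<Rightarrow> (nat \<times> nat \<Rightarrow> complex) \<Rightarrow> (nat \<Rightarrow> nat) \<Rightarrow> complex" where
  "kron k X = (\<lambda>\<alpha>. \<Prod>j<k. X (j, \<alpha> j))"

definition outer :: "((nat \<Rightarrow> nat) \<Rightarrow> real) \<Rightarrow> (nat \<Rightarrow> nat) \<Rightarrow> (nat \<Rightarrow> nat) \<Rightarrow> real" where
  "outer g = (\<lambda>\<alpha> \<beta>. g \<alpha> * g \<beta>)"

definition mtrace :: "'i set \<Rightarrow> ('i \<Rightarrow> 'i \<Rightarrow> real) \<Rightarrow> real" where
  "mtrace I A = (\<Sum>\<alpha>\<in>I. A \<alpha> \<alpha>)"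

definition qform :: "'i set \<Rightarrow> ('i \<Rightarrow> 'i \<Rightarrow> real) \<Rightarrow> ('i \<Rightarrow> complex) \<Rightarrow> complex" where
  "qform I A x = (\<Sum>\<alpha>\<in>I. \<Sum>\<beta>\<in>I. cnj (x \<alpha>) * complex_of_real (A \<alpha> \<beta>) * x \<beta>)"

definition cvariance :: "'a measure \<Rightarrow> ('a \<Rightarrow> complex) \<Rightarrow> real" where
  "cvariance M f = (\<integral>\<omega>. (cmod (f \<omega> - (\<integral>\<omega>'. f \<omega>' \<partial>M)))\<^sup>2 \<partial>M)"

definition hutchinson :: "nat \<Rightarrow> nat \<Rightarrow> nat \<Rightarrow> ((nat \<Rightarrow> nat) \<Rightarrow> (nat \<Rightarrow> nat) \<Rightarrow> real)
    \<Rightarrow> (nat \<times> nat \<times> nat \<Rightarrow> complex) \<Rightarrow> complex" where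
  "hutchinson d k l A Y =
     (1 / of_nat l) * (\<Sum>s<l. qform (tidx d k) A (kron k (\<lambda>(j, i). Y (s, j, i))))"

end

theory Submission
  imports Defs
begin

text \<open>
  Since A = g g^T, the quadratic form is |z|^2 with z the linear form of g evaluated at x, and its
  conditional variance is at most W(g) = E_x |z|^4. Exchanging the expectations, for fixed x the
  real and imaginary parts of z are linear forms in a standard Gaussian vector, whence
  E_g |z|^4 <= 6 |x|^4; and E_x |x|^4 factorises over the k modes and is at most
  (d^2 + d)^k = D^2 (1 + 1/d)^k with D = d^k. Markov's inequality bounds W(g) by a multiple of
  D^2 (1 + 1/d)^k, and a small-ball estimate gives tr(A) = |g|^2 >= c D, both with high
  probability over g. Given such a g, the estimator is an unbiased average of independent copies,
  and Chebyshev's inequality concludes.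
\<close>

text \<open>No bound of the required size holds for every g: if g is a standard basis vector and all
  factors are complex Gaussian, then z is a product of k entries and E_x |z|^4 = 2^k with trace 1,
  which exceeds (1 + 1/d)^k by an exponential factor as soon as d \<ge> 2. Hence the average over g
  has to be taken before x is integrated: for fixed x the form z sees x only through |x|, and the
  adverse directions of g are averaged out. The term 1/d is produced by complex entries, for which
  E|c|^4 \<le> 2. Real Gaussian entries have fourth moment 3 and would give 1 + 2/d per mode. The
  lower bound on |g|^2 must cover every D, including D = 1. Chebyshev's inequality with variance 2D
  is void for small D, so coordinates that are not small are counted instead; this uses only a
  bounded density. Failure probabilities are budgeted as 1/8 + 1/8 for g and 1/12 for the estimator.
  Together with the moment constant 6 and the norm constant 512 this fixes C = 12 * (8 * 6) *
  512^2.\<close>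

section \<open>One-dimensional laws and their moments\<close>

text \<open>These moments are the common ground of the Rademacher and the Gaussian law. Vanishing
  odd moments remove the odd terms of binomial expansions; the value 3 is attained by the Gaussian,
  while Rademacher has 1.\<close>

locale standardized_law = prob_space \<mu> for \<mu> :: "real measure" +
  assumes sets_eq_borel [measurable_cong, simp]: "sets \<mu> = sets borel"
    and integrable_power: "integrable \<mu> (\<lambda>x. x ^ n)"
    and first_moment: "(\<integral>x. x \<partial>\<mu>) = 0"
    and second_moment: "(\<integral>x. x\<^sup>2 \<partial>\<mu>) = 1"
    and third_moment: "(\<integral>x. x ^ 3 \<partial>\<mu>) = 0"
    and fourth_moment: "(\<integral>x. x ^ 4 \<partial>\<mu>) \<le> 3"

lemma standardized_law_rademacher: "standardized_law rademacher_real"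
proof -
  have ps: "prob_space rademacher_real"
    unfolding rademacher_real_def
    by (intro prob_space.prob_space_distr measure_pmf.prob_space_axioms) simp
  have int: "integrable rademacher_real f" if "f \<in> borel_measurable borel" for f :: "real \<Rightarrow> real"
    unfolding rademacher_real_def using that
    by (subst integrable_distr_eq) (auto intro!: integrable_measure_pmf_finite)
  have E: "(\<integral>x. f x \<partial>rademacher_real) = (f 1 + f (-1)) / 2" if "f \<in> borel_measurable borel" for f :: "real \<Rightarrow> real"
    unfolding rademacher_real_def using that
    by (subst integral_distr) (auto simp: integral_pmf_of_set)
  interpret prob_space rademacher_real by fact
  show ?thesis
  proof
    show "sets rademacher_real = sets borel" by (simp add: rademacher_real_def)
  qed (simp_all add: E int)
qed

lemma standardized_law_gaussian: "standardized_law gaussian_real"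
proof -
  have ps: "prob_space gaussian_real"
    unfolding gaussian_real_def by (rule prob_space_normal_density) simp
  have int: "integrable gaussian_real (\<lambda>x. x ^ n)" for n
    unfolding gaussian_real_def
    by (subst integrable_density) (auto intro: integrable_std_normal_moment)
  have E: "(\<integral>x. x ^ n \<partial>gaussian_real) = (\<integral>x. std_normal_density x * x ^ n \<partial>lborel)" for n
    unfolding gaussian_real_def by (subst integral_density) auto
  interpret prob_space gaussian_real by fact
  show ?thesis
  proof
    show "(\<integral>x. x \<partial>gaussian_real) = 0"
      using E[of 1] integral_std_normal_moment_odd[of 0] by simp
    show "(\<integral>x. x\<^sup>2 \<partial>gaussian_real) = 1"
      using E[of 2] integral_std_normal_moment_even[of 1] by simp
    show "(\<integral>x. x ^ 3 \<partial>gaussian_real) = 0"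
      using E[of 3] integral_std_normal_moment_odd[of 1] by (simp add: numeral_3_eq_3)
    show "(\<integral>x. x ^ 4 \<partial>gaussian_real) \<le> 3"
      using E[of 4] integral_std_normal_moment_even[of 2] by (simp add: fact_numeral)
  qed (auto simp: int, simp_all add: gaussian_real_def)
qed

context standardized_law
begin

lemma nn_integral_affine_square:
  "(\<integral>\<^sup>+y. ennreal ((s + y * u)\<^sup>2) \<partial>\<mu>) = ennreal (s\<^sup>2 + u\<^sup>2)"
proof -
  have i: "integrable \<mu> (\<lambda>x. x)" "integrable \<mu> (\<lambda>x. x\<^sup>2)"
    using integrable_power[of 1] integrable_power[of 2] by auto
  have eq: "(s + y * u)\<^sup>2 = s\<^sup>2 + (2 * s * u) * y + u\<^sup>2 * y\<^sup>2" for y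
    by algebra
  have "integrable \<mu> (\<lambda>y. (s + y * u)\<^sup>2)"
    unfolding eq using i by auto
  moreover have "(\<integral>y. (s + y * u)\<^sup>2 \<partial>\<mu>) = s\<^sup>2 + u\<^sup>2"
    unfolding eq using i by (simp add: first_moment second_moment prob_space)
  ultimately show ?thesis
    by (subst nn_integral_eq_integral) auto
qed

text \<open>One coordinate step of the induction for linear forms: s stands for the form in the
  other coordinates. The terms odd in y integrate to zero, and 3 bounds the last moment.\<close>

lemma nn_integral_affine_fourth_power:
  "(\<integral>\<^sup>+y. ennreal ((s + y * u) ^ 4) \<partial>\<mu>) \<le> ennreal (s ^ 4 + 6 * u\<^sup>2 * s\<^sup>2 + 3 * u ^ 4)"
proof -
  have i: "integrable \<mu> (\<lambda>x. x)" "integrable \<mu> (\<lambda>x. x\<^sup>2)" "integrable \<mu> (\<lambda>x. x ^ 3)" "integrable \<mu> (\<lambda>x. x ^ 4)"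
    using integrable_power[of 1] integrable_power[of 2] integrable_power[of 3] integrable_power[of 4] by auto
  have eq: "(s + y * u) ^ 4 = s ^ 4 + (4 * s ^ 3 * u) * y + (6 * u\<^sup>2 * s\<^sup>2) * y\<^sup>2 + (4 * s * u ^ 3) * y ^ 3 + u ^ 4 * y ^ 4" for y
    by algebra
  have "integrable \<mu> (\<lambda>y. (s + y * u) ^ 4)"
    unfolding eq using i by auto
  moreover have "(\<integral>y. (s + y * u) ^ 4 \<partial>\<mu>) = s ^ 4 + 6 * u\<^sup>2 * s\<^sup>2 + u ^ 4 * (\<integral>y. y ^ 4 \<partial>\<mu>)"
    unfolding eq using i by (simp add: first_moment second_moment third_moment prob_space)
  moreover have "u ^ 4 * (\<integral>y. y ^ 4 \<partial>\<mu>) \<le> u ^ 4 * 3"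
    by (intro mult_left_mono fourth_moment) auto
  ultimately show ?thesis
    by (subst nn_integral_eq_integral) (auto intro!: ennreal_leI)
qed

lemma measurable_entry [measurable]:
  "(\<lambda>(r, m). complex_of_real (r / sqrt 2) + \<i> * complex_of_real (m / sqrt 2)) \<in> borel_measurable (\<mu> \<Otimes>\<^sub>M \<mu>)"
  by (simp add: case_prod_unfold)

lemma prob_space_complex_entry: "prob_space (complex_entry \<mu>)"
proof -
  interpret P: pair_prob_space \<mu> \<mu> ..
  show ?thesis
    unfolding complex_entry_def by (rule P.prob_space_distr) measurable
qed

lemma cmod_entry: "(cmod (complex_of_real (r / sqrt 2) + \<i> * complex_of_real (m / sqrt 2)))\<^sup>2 = (r\<^sup>2 + m\<^sup>2) / 2"
  by (simp add: cmod_power2 power_divide add_divide_distrib)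

lemma nn_integral_complex_entry_square:
  "(\<integral>\<^sup>+c. ennreal ((cmod c)\<^sup>2) \<partial>complex_entry \<mu>) = 1"
proof -
  have i: "integrable \<mu> (\<lambda>x. x\<^sup>2)" by (rule integrable_power)
  have "(\<integral>\<^sup>+c. ennreal ((cmod c)\<^sup>2) \<partial>complex_entry \<mu>) = (\<integral>\<^sup>+p. ennreal (((fst p)\<^sup>2 + (snd p)\<^sup>2) / 2) \<partial>(\<mu> \<Otimes>\<^sub>M \<mu>))"
    unfolding complex_entry_def
    by (subst nn_integral_distr) (auto simp only: cmod_entry case_prod_unfold intro!: measurable_entry[unfolded case_prod_unfold], measurable)
  also have "\<dots> = (\<integral>\<^sup>+r. \<integral>\<^sup>+m. ennreal ((r\<^sup>2 + m\<^sup>2) / 2) \<partial>\<mu> \<partial>\<mu>)"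
    by (subst nn_integral_fst[symmetric]) auto
  also have "\<dots> = (\<integral>\<^sup>+r. ennreal ((r\<^sup>2 + 1) / 2) \<partial>\<mu>)"
    using i by (intro nn_integral_cong, subst nn_integral_eq_integral) (auto simp: second_moment prob_space)
  also have "\<dots> = 1"
    using i by (subst nn_integral_eq_integral) (auto simp: second_moment prob_space)
  finally show ?thesis .
qed

text \<open>With F the real fourth moment, expanding the square of (r^2 + m^2) / 2 gives F/2 + 1/2,
  so F \<le> 3 yields 2. Equality holds for Gaussian entries.\<close>

lemma nn_integral_complex_entry_fourth_power:
  "(\<integral>\<^sup>+c. ennreal ((cmod c) ^ 4) \<partial>complex_entry \<mu>) \<le> 2"
proof -
  have i: "integrable \<mu> (\<lambda>x. x\<^sup>2)" "integrable \<mu> (\<lambda>x. x ^ 4)" by (rule integrable_power)+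
  \<comment> \<open>Fourth powers become squares of squares so that \<open>cmod_entry\<close> can
    rewrite the inner one.\<close>
  have 4: "x ^ 4 = (x\<^sup>2)\<^sup>2" for x :: real by simp
  define F where "F = (\<integral>x. x ^ 4 \<partial>\<mu>)"
  have eq: "((r\<^sup>2 + m\<^sup>2) / 2)\<^sup>2 = r ^ 4 / 4 + (r\<^sup>2 / 2) * m\<^sup>2 + m ^ 4 / 4" for r m :: real
    by (simp add: power2_eq_square power4_eq_xxxx field_simps)
  have "(\<integral>\<^sup>+c. ennreal ((cmod c) ^ 4) \<partial>complex_entry \<mu>) = (\<integral>\<^sup>+p. ennreal ((((fst p)\<^sup>2 + (snd p)\<^sup>2) / 2)\<^sup>2) \<partial>(\<mu> \<Otimes>\<^sub>M \<mu>))"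
    unfolding complex_entry_def 4
    by (subst nn_integral_distr) (auto simp only: cmod_entry case_prod_unfold intro!: measurable_entry[unfolded case_prod_unfold], measurable)
  also have "\<dots> = (\<integral>\<^sup>+r. \<integral>\<^sup>+m. ennreal (((r\<^sup>2 + m\<^sup>2) / 2)\<^sup>2) \<partial>\<mu> \<partial>\<mu>)"
    by (subst nn_integral_fst[symmetric]) auto
  also have "\<dots> = (\<integral>\<^sup>+r. ennreal (r ^ 4 / 4 + r\<^sup>2 / 2 + F / 4) \<partial>\<mu>)"
    unfolding eq using i by (intro nn_integral_cong, subst nn_integral_eq_integral)
      (auto simp: second_moment prob_space F_def)
  also have "\<dots> = ennreal (F / 4 + 1 / 2 + F / 4)"
    using i by (subst nn_integral_eq_integral)
      (auto simp: second_moment prob_space F_def intro!: add_nonneg_nonneg divide_nonneg_nonneg integral_nonneg)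
  also have "\<dots> \<le> ennreal 2"
    using fourth_moment by (intro ennreal_leI) (simp add: F_def)
  finally show ?thesis by simp
qed

lemma integral_complex_entry:
  "integrable (complex_entry \<mu>) (\<lambda>c. c)" "(\<integral>c. c \<partial>complex_entry \<mu>) = 0"
proof -
  interpret P: pair_prob_space \<mu> \<mu> ..
  have i: "integrable \<mu> (\<lambda>x. x)" using integrable_power[of 1] by simp
  have f: "integrable (\<mu> \<Otimes>\<^sub>M \<mu>) (\<lambda>p. complex_of_real (fst p))" 
          "integrable (\<mu> \<Otimes>\<^sub>M \<mu>) (\<lambda>p. complex_of_real (snd p))"
     and z: "(\<integral>p. complex_of_real (fst p) \<partial>(\<mu> \<Otimes>\<^sub>M \<mu>)) = 0"
          "(\<integral>p. complex_of_real (snd p) \<partial>(\<mu> \<Otimes>\<^sub>M \<mu>)) = 0"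
  proof -
    have d: "integrable (distr (\<mu> \<Otimes>\<^sub>M \<mu>) \<mu> fst) complex_of_real"
      "(\<integral>x. complex_of_real x \<partial>distr (\<mu> \<Otimes>\<^sub>M \<mu>) \<mu> fst) = 0"
      using i by (auto simp: distr_pair_fst first_moment)
    show f1: "integrable (\<mu> \<Otimes>\<^sub>M \<mu>) (\<lambda>p. complex_of_real (fst p))"
      using d(1) by (subst (asm) integrable_distr_eq) auto
    show "integrable (\<mu> \<Otimes>\<^sub>M \<mu>) (\<lambda>p. complex_of_real (snd p))"
      using P.integrable_product_swap[OF f1] by (simp add: case_prod_unfold)
    show z1: "(\<integral>p. complex_of_real (fst p) \<partial>(\<mu> \<Otimes>\<^sub>M \<mu>)) = 0"
      using d(2) by (subst (asm) integral_distr) auto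
    show "(\<integral>p. complex_of_real (snd p) \<partial>(\<mu> \<Otimes>\<^sub>M \<mu>)) = 0"
      using P.integral_product_swap[of "\<lambda>p. complex_of_real (fst p)"] z1 by (simp add: case_prod_unfold)
  qed
  show "integrable (complex_entry \<mu>) (\<lambda>c. c)"
    unfolding complex_entry_def using f
    unfolding case_prod_unfold by (subst integrable_distr_eq) simp_all
  show "(\<integral>c. c \<partial>complex_entry \<mu>) = 0"
    unfolding complex_entry_def using f z
    unfolding case_prod_unfold by (subst integral_distr) simp_all
qed

end

section \<open>Moments of linear forms in independent coordinates\<close>

context standardized_law
begin

lemma product_prob_space_const: "product_prob_space (\<lambda>_::'i. \<mu>)"
  by unfold_locales

lemma nn_integral_linear_form_square:
  assumes "finite I"
  shows "(\<integral>\<^sup>+g. ennreal ((\<Sum>i\<in>I. g i * u i)\<^sup>2) \<partial>PiM I (\<lambda>_. \<mu>)) = ennreal (\<Sum>i\<in>I. (u i)\<^sup>2)"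
  using assms
proof (induction I)
  case empty
  show ?case by simp
next
  case (insert i I)
  interpret I: prob_space "PiM I (\<lambda>_. \<mu>)" by (rule prob_space_PiM) (rule prob_space_axioms)
  interpret product_prob_space "\<lambda>_. \<mu>" by (rule product_prob_space_const)
  have eq: "(\<Sum>j\<in>I. (if j = i then y else x j) * u j) = (\<Sum>j\<in>I. x j * u j)" for x y
    using insert.hyps by (intro sum.cong) auto
  have "(\<integral>\<^sup>+g. ennreal ((\<Sum>j\<in>insert i I. g j * u j)\<^sup>2) \<partial>PiM (insert i I) (\<lambda>_. \<mu>)) =
    (\<integral>\<^sup>+x. (\<integral>\<^sup>+y. ennreal (((\<Sum>j\<in>I. x j * u j) + y * u i)\<^sup>2) \<partial>\<mu>) \<partial>PiM I (\<lambda>_. \<mu>))"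
    using insert.hyps by (subst product_nn_integral_insert) (auto simp: eq add.commute)
  also have "\<dots> = (\<integral>\<^sup>+x. ennreal ((\<Sum>j\<in>I. x j * u j)\<^sup>2) + ennreal ((u i)\<^sup>2) \<partial>PiM I (\<lambda>_. \<mu>))"
    by (simp add: nn_integral_affine_square)
  also have "\<dots> = ennreal (\<Sum>i\<in>I. (u i)\<^sup>2) + ennreal ((u i)\<^sup>2)"
    by (subst nn_integral_add) (auto simp: insert.IH I.emeasure_space_1)
  finally show ?case
    using insert.hyps by (simp add: sum_nonneg add.commute flip: ennreal_plus)
qed

text \<open>The constant 3 reproduces itself under insertion of a coordinate, because 3 U^2 + 6 u^2
  U + 3 u^4 = 3 (u^2 + U)^2. The cross term needs the exact second moment of the shorter form,
  whence the preceding lemma.\<close>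

lemma nn_integral_linear_form_fourth_power:
  assumes "finite I"
  shows "(\<integral>\<^sup>+g. ennreal ((\<Sum>i\<in>I. g i * u i) ^ 4) \<partial>PiM I (\<lambda>_. \<mu>)) \<le> ennreal (3 * (\<Sum>i\<in>I. (u i)\<^sup>2)\<^sup>2)"
  using assms
proof (induction I)
  case empty
  show ?case by simp
next
  case (insert i I)
  interpret I: prob_space "PiM I (\<lambda>_. \<mu>)" by (rule prob_space_PiM) (rule prob_space_axioms)
  interpret product_prob_space "\<lambda>_. \<mu>" by (rule product_prob_space_const)
  define U where "U = (\<Sum>i\<in>I. (u i)\<^sup>2)"
  have U: "U \<ge> 0" by (simp add: U_def sum_nonneg)
  have eq: "(\<Sum>j\<in>I. (if j = i then y else x j) * u j) = (\<Sum>j\<in>I. x j * u j)" for x y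
    using insert.hyps by (intro sum.cong) auto
  have "(\<integral>\<^sup>+g. ennreal ((\<Sum>j\<in>insert i I. g j * u j) ^ 4) \<partial>PiM (insert i I) (\<lambda>_. \<mu>)) =
    (\<integral>\<^sup>+x. (\<integral>\<^sup>+y. ennreal (((\<Sum>j\<in>I. x j * u j) + y * u i) ^ 4) \<partial>\<mu>) \<partial>PiM I (\<lambda>_. \<mu>))"
    using insert.hyps by (subst product_nn_integral_insert) (auto simp: eq add.commute)
  also have "\<dots> \<le> (\<integral>\<^sup>+x. ennreal ((\<Sum>j\<in>I. x j * u j) ^ 4)
      + (ennreal (6 * (u i)\<^sup>2) * ennreal ((\<Sum>j\<in>I. x j * u j)\<^sup>2) + ennreal (3 * (u i) ^ 4)) \<partial>PiM I (\<lambda>_. \<mu>))"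
    by (intro nn_integral_mono order.trans[OF nn_integral_affine_fourth_power])
       (simp add: add_ac flip: ennreal_plus ennreal_mult)
  also have "\<dots> = (\<integral>\<^sup>+x. ennreal ((\<Sum>j\<in>I. x j * u j) ^ 4) \<partial>PiM I (\<lambda>_. \<mu>))
      + (ennreal (6 * (u i)\<^sup>2) * ennreal U + ennreal (3 * (u i) ^ 4))"
    by (simp add: nn_integral_add nn_integral_cmult nn_integral_linear_form_square[OF insert.hyps(1)]
         I.emeasure_space_1 U_def)
  also have "\<dots> \<le> ennreal (3 * U\<^sup>2) + (ennreal (6 * (u i)\<^sup>2) * ennreal U + ennreal (3 * (u i) ^ 4))"
    using insert.IH by (intro add_right_mono) (simp add: U_def)
  also have "\<dots> = ennreal (3 * ((u i)\<^sup>2 + U)\<^sup>2)"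
  proof -
    have "3 * ((u i)\<^sup>2 + U)\<^sup>2 = 3 * U\<^sup>2 + (6 * (u i)\<^sup>2 * U + 3 * (u i) ^ 4)"
      by algebra
    then show ?thesis
      using U by (simp flip: ennreal_plus ennreal_mult)
  qed
  finally show ?case
    using insert.hyps by (simp add: U_def)
qed

text \<open>Real and imaginary part are real linear forms in the same vector, and their dependence
  is harmless: separating them costs a factor 2, which turns 3 into 6, and then U^2 + V^2 \<le> (U +
  V)^2.\<close>

lemma nn_integral_complex_linear_form_fourth_power:
  fixes x :: "'i \<Rightarrow> complex"
  assumes "finite I"
  shows "(\<integral>\<^sup>+g. ennreal (cmod (\<Sum>i\<in>I. complex_of_real (g i) * x i) ^ 4) \<partial>PiM I (\<lambda>_. \<mu>))
    \<le> ennreal (6 * (\<Sum>i\<in>I. (cmod (x i))\<^sup>2)\<^sup>2)"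
proof -
  define U where "U = (\<Sum>i\<in>I. (Re (x i))\<^sup>2)"
  define V where "V = (\<Sum>i\<in>I. (Im (x i))\<^sup>2)"
  have UV: "U \<ge> 0" "V \<ge> 0" by (auto simp: U_def V_def sum_nonneg)
  have c4: "cmod z ^ 4 \<le> 2 * Re z ^ 4 + 2 * Im z ^ 4" for z
  proof -
    have "cmod z ^ 4 = ((Re z)\<^sup>2 + (Im z)\<^sup>2)\<^sup>2"
      by (simp flip: cmod_power2)
    \<comment> \<open>The added square cancels the mixed term.\<close>
    also have "\<dots> \<le> ((Re z)\<^sup>2 + (Im z)\<^sup>2)\<^sup>2 + ((Re z)\<^sup>2 - (Im z)\<^sup>2)\<^sup>2"
      by simp
    also have "\<dots> = 2 * Re z ^ 4 + 2 * Im z ^ 4"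
      by algebra
    finally show ?thesis .
  qed
  have "(\<integral>\<^sup>+g. ennreal (cmod (\<Sum>i\<in>I. complex_of_real (g i) * x i) ^ 4) \<partial>PiM I (\<lambda>_. \<mu>)) \<le>
    (\<integral>\<^sup>+g. 2 * ennreal ((\<Sum>i\<in>I. g i * Re (x i)) ^ 4) + 2 * ennreal ((\<Sum>i\<in>I. g i * Im (x i)) ^ 4) \<partial>PiM I (\<lambda>_. \<mu>))"
  proof (rule nn_integral_mono)
    fix g :: "'i \<Rightarrow> real"
    have "ennreal (cmod (\<Sum>i\<in>I. complex_of_real (g i) * x i) ^ 4) \<le>
        ennreal (2 * (\<Sum>i\<in>I. g i * Re (x i)) ^ 4 + 2 * (\<Sum>i\<in>I. g i * Im (x i)) ^ 4)"
      using c4[of "\<Sum>i\<in>I. complex_of_real (g i) * x i"] by (intro ennreal_leI) simp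
    then show "ennreal (cmod (\<Sum>i\<in>I. complex_of_real (g i) * x i) ^ 4) \<le>
        2 * ennreal ((\<Sum>i\<in>I. g i * Re (x i)) ^ 4) + 2 * ennreal ((\<Sum>i\<in>I. g i * Im (x i)) ^ 4)"
      by (simp add: ennreal_mult)
  qed
  also have "\<dots> = 2 * (\<integral>\<^sup>+g. ennreal ((\<Sum>i\<in>I. g i * Re (x i)) ^ 4) \<partial>PiM I (\<lambda>_. \<mu>))
      + 2 * (\<integral>\<^sup>+g. ennreal ((\<Sum>i\<in>I. g i * Im (x i)) ^ 4) \<partial>PiM I (\<lambda>_. \<mu>))"
    by (simp add: nn_integral_add nn_integral_cmult)
  also have "\<dots> \<le> 2 * ennreal (3 * U\<^sup>2) + 2 * ennreal (3 * V\<^sup>2)"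
    unfolding U_def V_def
    by (intro add_mono mult_left_mono nn_integral_linear_form_fourth_power assms) auto
  also have "\<dots> = ennreal (6 * U\<^sup>2 + 6 * V\<^sup>2)"
    using UV by (simp add: ennreal_mult)
  also have "\<dots> \<le> ennreal (6 * (U + V)\<^sup>2)"
    using UV by (intro ennreal_leI) (simp add: power2_sum)
  also have "U + V = (\<Sum>i\<in>I. (cmod (x i))\<^sup>2)"
    by (simp add: U_def V_def cmod_power2 sum.distrib)
  finally show ?thesis .
qed

end

section \<open>The law of a complex entry\<close>

text \<open>From here on these facts stand for both kinds of entry, so the modes may mix Rademacher
  and Gaussian factors without any case distinction.\<close>

lemma prob_space_entry_law: "prob_space (entry_law b)"
  and sets_entry_law [measurable_cong, simp]: "sets (entry_law b) = sets borel"
  and integrable_entry_law: "integrable (entry_law b) (\<lambda>c. c)"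
  and integral_entry_law: "(\<integral>c. c \<partial>entry_law b) = 0"
  and nn_integral_entry_law_square: "(\<integral>\<^sup>+c. ennreal ((cmod c)\<^sup>2) \<partial>entry_law b) = 1"
  and nn_integral_entry_law_fourth_power: "(\<integral>\<^sup>+c. ennreal ((cmod c) ^ 4) \<partial>entry_law b) \<le> 2"
proof -
  interpret R: standardized_law rademacher_real by (rule standardized_law_rademacher)
  interpret G: standardized_law gaussian_real by (rule standardized_law_gaussian)
  show "prob_space (entry_law b)" "integrable (entry_law b) (\<lambda>c. c)" "(\<integral>c. c \<partial>entry_law b) = 0"
    "(\<integral>\<^sup>+c. ennreal ((cmod c)\<^sup>2) \<partial>entry_law b) = 1"
    "(\<integral>\<^sup>+c. ennreal ((cmod c) ^ 4) \<partial>entry_law b) \<le> 2"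
    by (simp_all add: entry_law_def R.prob_space_complex_entry G.prob_space_complex_entry
        R.integral_complex_entry G.integral_complex_entry
        R.nn_integral_complex_entry_square G.nn_integral_complex_entry_square
        R.nn_integral_complex_entry_fourth_power G.nn_integral_complex_entry_fourth_power)
  show "sets (entry_law b) = sets borel"
    by (simp add: entry_law_def complex_entry_def)
qed

lemma integrable_entry_law_cnj_mult: "integrable (entry_law b) (\<lambda>c. cnj c * c)"
  and integral_entry_law_cnj_mult: "(\<integral>c. cnj c * c \<partial>entry_law b) = 1"
proof -
  have i: "integrable (entry_law b) (\<lambda>c. (cmod c)\<^sup>2)"
    by (rule integrableI_bounded) (auto simp: nn_integral_entry_law_square)
  have e: "(\<integral>c. (cmod c)\<^sup>2 \<partial>entry_law b) = 1"
    by (subst integral_eq_nn_integral) (auto simp: nn_integral_entry_law_square)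
  have eq: "cnj c * c = complex_of_real ((cmod c)\<^sup>2)" for c
    by (metis complex_norm_square mult.commute)
  show "integrable (entry_law b) (\<lambda>c. cnj c * c)" "(\<integral>c. cnj c * c \<partial>entry_law b) = 1"
    unfolding eq using i e by (auto simp del: of_real_power)
qed

lemma product_prob_space_entry_law: "product_prob_space (\<lambda>p. entry_law (f p))"
proof -
  interpret prob_space "entry_law b" for b by (rule prob_space_entry_law)
  show ?thesis by unfold_locales
qed

section \<open>Second and fourth moments of the Kronecker vector\<close>

lemma finite_tidx [simp]: "finite (tidx d k)"
  and card_tidx: "card (tidx d k) = d ^ k"
  by (auto simp: tidx_def finite_PiE card_PiE)

lemma tidx_less: "\<alpha> \<in> tidx d k \<Longrightarrow> j < k \<Longrightarrow> \<alpha> j < d"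
  by (auto simp: tidx_def)

lemma factors_law_eq: "factors_law d k t = PiM ({0..<k} \<times> {0..<d}) (\<lambda>p. entry_law (t (fst p)))"
  unfolding factors_law_def by (simp add: case_prod_unfold)

lemma copies_law_eq: "copies_law d k t l = PiM ({0..<l} \<times> {0..<k} \<times> {0..<d}) (\<lambda>p. entry_law (t (fst (snd p))))"
  unfolding copies_law_def by (simp add: case_prod_unfold)

text \<open>Writes the product over modes as a product over all entries, so that the expectation
  factorises over the product measure.\<close>
lemma prod_kron_as_entries:
  fixes F G :: "complex \<Rightarrow> 'a :: comm_monoid_mult"
  assumes "\<alpha> \<in> tidx d k" "\<beta> \<in> tidx d k"
  shows "(\<Prod>j<k. F (X (j, \<alpha> j))) * (\<Prod>j<k. G (X (j, \<beta> j))) =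
    (\<Prod>p\<in>{0..<k} \<times> {0..<d}. (if \<alpha> (fst p) = snd p then F (X p) else 1) * (if \<beta> (fst p) = snd p then G (X p) else 1))"
proof -
  have "(\<Prod>p\<in>{0..<k} \<times> {0..<d}. (if \<alpha> (fst p) = snd p then F (X p) else 1) * (if \<beta> (fst p) = snd p then G (X p) else 1)) =
    (\<Prod>j\<in>{0..<k}. \<Prod>i\<in>{0..<d}. (if \<alpha> j = i then F (X (j, i)) else 1) * (if \<beta> j = i then G (X (j, i)) else 1))"
    by (subst prod.cartesian_product) (auto intro!: prod.cong)
  also have "\<dots> = (\<Prod>j\<in>{0..<k}. F (X (j, \<alpha> j)) * G (X (j, \<beta> j)))"
    using assms by (intro prod.cong refl) (simp add: prod.distrib tidx_less)
  finally show ?thesis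
    by (simp add: prod.distrib atLeast0LessThan)
qed

text \<open>Isotropy of x. The expectation factorises over all entries: one selected by both indices
  contributes E|c|^2 = 1, one selected by neither contributes 1, and one selected by exactly one of
  them contributes the mean 0.\<close>

lemma kron_second_moment:
  assumes \<alpha>: "\<alpha> \<in> tidx d k" and \<beta>: "\<beta> \<in> tidx d k"
  shows "integrable (factors_law d k t) (\<lambda>X. cnj (kron k X \<alpha>) * kron k X \<beta>)"
    and "(\<integral>X. cnj (kron k X \<alpha>) * kron k X \<beta> \<partial>factors_law d k t) = (if \<alpha> = \<beta> then 1 else 0)"
proof -
  interpret product_prob_space "\<lambda>p::nat \<times> nat. entry_law (t (fst p))" by (rule product_prob_space_entry_law)
  define f where "f = (\<lambda>(p::nat \<times> nat) c. (if \<alpha> (fst p) = snd p then cnj c else 1) * (if \<beta> (fst p) = snd p then c else 1))"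
  have eq: "cnj (kron k X \<alpha>) * kron k X \<beta> = (\<Prod>p\<in>{0..<k} \<times> {0..<d}. f p (X p))" for X
    using prod_kron_as_entries[OF assms, of cnj X "\<lambda>x. x"] by (simp add: kron_def f_def)
  have i: "integrable (entry_law (t (fst p))) (f p)" for p
    unfolding f_def using integrable_entry_law integrable_entry_law_cnj_mult
    by (cases "\<alpha> (fst p) = snd p"; cases "\<beta> (fst p) = snd p") (simp_all)
  have e: "integral\<^sup>L (entry_law (t (fst p))) (f p) = (if \<alpha> (fst p) = snd p \<longleftrightarrow> \<beta> (fst p) = snd p then 1 else 0)" for p
    unfolding f_def using integral_entry_law integral_entry_law_cnj_mult M.prob_space
    by (cases "\<alpha> (fst p) = snd p"; cases "\<beta> (fst p) = snd p") (simp_all add: integral_cnj)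
  show "integrable (factors_law d k t) (\<lambda>X. cnj (kron k X \<alpha>) * kron k X \<beta>)"
    unfolding eq factors_law_eq by (intro product_integrable_prod i) auto
  have "(\<integral>X. cnj (kron k X \<alpha>) * kron k X \<beta> \<partial>factors_law d k t) = (\<Prod>p\<in>{0..<k} \<times> {0..<d}. if \<alpha> (fst p) = snd p \<longleftrightarrow> \<beta> (fst p) = snd p then 1 else 0)"
    unfolding eq factors_law_eq by (subst product_integral_prod) (auto simp: i e intro!: prod.cong)
  also have "\<dots> = (if \<alpha> = \<beta> then 1 else 0)"
  proof (cases "\<alpha> = \<beta>")
    case False
    then obtain j where j: "j < k" "\<alpha> j \<noteq> \<beta> j"
      using \<alpha> \<beta> by (metis PiE_ext tidx_def atLeast0LessThan lessThan_iff)
    \<comment> \<open>In a mode where the indices differ, the entry at position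
      \<open>\<alpha> j\<close> is selected by \<alpha> alone, which gives a zero factor.\<close>
    then have "\<exists>p\<in>{0..<k} \<times> {0..<d}. (if \<alpha> (fst p) = snd p \<longleftrightarrow> \<beta> (fst p) = snd p then 1 else 0) = (0 :: complex)"
      using tidx_less[OF \<alpha> j(1)] by (intro bexI[of _ "(j, \<alpha> j)"]) auto
    then show ?thesis
      using False by (subst prod_zero) auto
  qed auto
  finally show "(\<integral>X. cnj (kron k X \<alpha>) * kron k X \<beta> \<partial>factors_law d k t) = (if \<alpha> = \<beta> then 1 else 0)" .
qed

text \<open>Squaring the norm gives a sum over pairs of multi-indices. A mode in which the pair
  agrees contributes a fourth moment, at most 2; a mode in which it differs contributes a product of
  two second moments, which is 1.\<close>

lemma nn_integral_kron_norm_fourth_power: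
  assumes d: "1 \<le> d"
  shows "(\<integral>\<^sup>+X. ennreal ((\<Sum>\<alpha>\<in>tidx d k. (cmod (kron k X \<alpha>))\<^sup>2)\<^sup>2) \<partial>factors_law d k t)
    \<le> ennreal ((real d ^ k)\<^sup>2 * (1 + 1 / real d) ^ k)"
proof -
  interpret product_prob_space "\<lambda>p::nat \<times> nat. entry_law (t (fst p))" by (rule product_prob_space_entry_law)
  let ?I = "{0..<k} \<times> {0..<d}"
  define h where "h = (\<lambda>c. ennreal ((cmod c)\<^sup>2))"
  have [measurable]: "h \<in> borel_measurable borel" by (simp add: h_def)
  define f where "f = (\<lambda>\<alpha> \<beta> (p::nat \<times> nat) c. (if \<alpha> (fst p) = snd p then h c else 1) * (if \<beta> (fst p) = snd p then h c else 1))"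
  have eq: "ennreal ((\<Sum>\<alpha>\<in>tidx d k. (cmod (kron k X \<alpha>))\<^sup>2)\<^sup>2) =
    (\<Sum>\<alpha>\<in>tidx d k. \<Sum>\<beta>\<in>tidx d k. \<Prod>p\<in>?I. f \<alpha> \<beta> p (X p))" for X
  proof -
    have k: "ennreal ((cmod (kron k X \<alpha>))\<^sup>2) = (\<Prod>j<k. h (X (j, \<alpha> j)))" for \<alpha>
      by (simp add: kron_def h_def prod_ennreal flip: prod_norm prod_power_distrib)
    have "ennreal ((\<Sum>\<alpha>\<in>tidx d k. (cmod (kron k X \<alpha>))\<^sup>2)\<^sup>2) = (\<Sum>\<alpha>\<in>tidx d k. ennreal ((cmod (kron k X \<alpha>))\<^sup>2))\<^sup>2"
      by (subst sum_ennreal) (auto simp: ennreal_power sum_nonneg)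
    also have "\<dots> = (\<Sum>\<alpha>\<in>tidx d k. \<Sum>\<beta>\<in>tidx d k. (\<Prod>j<k. h (X (j, \<alpha> j))) * (\<Prod>j<k. h (X (j, \<beta> j))))"
      unfolding k unfolding power2_eq_square by (rule sum_product)
    finally show ?thesis
      by (simp add: prod_kron_as_entries f_def)
  qed
  \<comment> \<open>The bound is deliberately asymmetric: an entry selected by \<beta> alone
    integrates to 1, so in each mode only the entry at \<open>\<alpha> j\<close> can carry a factor
    different from 1. This lets the product over entries collapse to one over modes.\<close>
  have fint: "(\<integral>\<^sup>+c. f \<alpha> \<beta> p c \<partial>entry_law (t (fst p))) \<le> (if snd p = \<alpha> (fst p) then (if \<alpha> (fst p) = \<beta> (fst p) then 2 else 1) else 1)" for \<alpha> \<beta> p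
  proof -
    have "h c * h c = ennreal (cmod c ^ 4)" for c
      by (simp add: h_def power4_eq_xxxx power2_eq_square mult_ac flip: ennreal_mult)
    then show ?thesis
      unfolding f_def
      using nn_integral_entry_law_square nn_integral_entry_law_fourth_power M.emeasure_space_1
      by (cases "\<alpha> (fst p) = snd p"; cases "\<beta> (fst p) = snd p") (auto simp: h_def)
  qed
  have inner: "(\<Sum>i\<in>{0..<d}. if a = i then 2 else 1) = (of_nat (d + 1) :: ennreal)" if "a < d" for a
  proof -
    have "(\<Sum>i\<in>{0..<d}. if a = i then 2 else 1) = (\<Sum>i\<in>{0..<d}. (if a = i then 1 else 0) + (1 :: ennreal))"
      by (intro sum.cong) auto
    also have "\<dots> = 1 + of_nat d"
      using that by (subst sum.distrib) simp
    finally show ?thesis by simp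
  qed
  have "(\<integral>\<^sup>+X. ennreal ((\<Sum>\<alpha>\<in>tidx d k. (cmod (kron k X \<alpha>))\<^sup>2)\<^sup>2) \<partial>factors_law d k t) =
    (\<Sum>\<alpha>\<in>tidx d k. \<Sum>\<beta>\<in>tidx d k. \<integral>\<^sup>+X. (\<Prod>p\<in>?I. f \<alpha> \<beta> p (X p)) \<partial>factors_law d k t)"
    unfolding eq factors_law_eq by (simp add: nn_integral_sum f_def)
  also have "\<dots> = (\<Sum>\<alpha>\<in>tidx d k. \<Sum>\<beta>\<in>tidx d k. \<Prod>p\<in>?I. \<integral>\<^sup>+c. f \<alpha> \<beta> p c \<partial>entry_law (t (fst p)))"
    unfolding factors_law_eq by (intro sum.cong refl product_nn_integral_prod) (auto simp: f_def)
  also have "\<dots> \<le> (\<Sum>\<alpha>\<in>tidx d k. \<Sum>\<beta>\<in>tidx d k. \<Prod>p\<in>?I. (if snd p = \<alpha> (fst p) then (if \<alpha> (fst p) = \<beta> (fst p) then 2 else 1) else 1))"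
    by (intro sum_mono prod_mono_ennreal fint)
  also have "\<dots> = (\<Sum>\<alpha>\<in>tidx d k. \<Sum>\<beta>\<in>tidx d k. \<Prod>j\<in>{0..<k}. if \<alpha> j = \<beta> j then 2 else 1)"
    by (intro sum.cong refl, subst prod.cartesian_product[symmetric, where g="\<lambda>j i. if i = _ j then (if _ j = _ j then 2 else 1) else 1", unfolded case_prod_unfold])
       (auto intro!: prod.cong simp: tidx_less)
  \<comment> \<open>Distributivity: the components of \<beta> are summed independently. In each mode
    one value agrees with \<open>\<alpha> j\<close> and d - 1 differ, giving 2 + (d - 1) = d +
    1.\<close>
  also have "\<dots> = (\<Sum>\<alpha>\<in>tidx d k. \<Prod>j\<in>{0..<k}. \<Sum>i\<in>{0..<d}. if \<alpha> j = i then 2 else 1)"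
    unfolding tidx_def by (intro sum.cong refl, subst prod_sum_PiE) auto
  also have "\<dots> = (\<Sum>\<alpha>\<in>tidx d k. of_nat (d + 1) ^ k)"
    by (intro sum.cong refl) (simp add: inner tidx_less del: of_nat_add of_nat_Suc)
  also have "\<dots> = ennreal (real (d ^ k * (d + 1) ^ k))"
    unfolding ennreal_of_nat_eq_real_of_nat[symmetric] by (simp add: card_tidx)
  also have "real (d ^ k * (d + 1) ^ k) = (real d ^ k)\<^sup>2 * (1 + 1 / real d) ^ k"
  proof -
    have "real d * (1 + 1 / real d) = real (d + 1)" using d by (simp add: field_simps)
    then have "real (d + 1) ^ k = real d ^ k * (1 + 1 / real d) ^ k" by (metis power_mult_distrib)
    then show ?thesis by (simp add: power2_eq_square)
  qed
  finally show ?thesis .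
qed

section \<open>The quadratic form as a squared modulus, and measurability\<close>

definition kron_form :: "nat \<Rightarrow> nat \<Rightarrow> ((nat \<Rightarrow> nat) \<Rightarrow> real) \<Rightarrow> (nat \<times> nat \<Rightarrow> complex) \<Rightarrow> complex" where
  "kron_form d k g X = (\<Sum>\<alpha>\<in>tidx d k. complex_of_real (g \<alpha>) * kron k X \<alpha>)"

text \<open>Since g is real, the rank-one form is a conjugate times itself. It is therefore real and
  nonnegative, and the complex variance and deviation reduce to real ones.\<close>

lemma qform_outer:
  "qform (tidx d k) (outer g) (kron k X) = complex_of_real ((cmod (kron_form d k g X))\<^sup>2)"
proof -
  have "complex_of_real ((cmod (kron_form d k g X))\<^sup>2) = cnj (kron_form d k g X) * kron_form d k g X"
    by (metis complex_norm_square mult.commute)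
  also have "\<dots> = qform (tidx d k) (outer g) (kron k X)"
    unfolding kron_form_def qform_def outer_def cnj_sum sum_product by (simp add: mult_ac)
  finally show ?thesis ..
qed

lemma mtrace_outer: "mtrace I (outer g) = (\<Sum>\<alpha>\<in>I. (g \<alpha>)\<^sup>2)"
  by (simp add: mtrace_def outer_def power2_eq_square)

text \<open>Points of a product space are \<open>undefined\<close> off the index set, while a slice
  of the copies is not restricted in this way; only the entries on the k by d grid count, so the two
  can be exchanged.\<close>

lemma kron_form_cong:
  assumes "\<And>j i. j < k \<Longrightarrow> i < d \<Longrightarrow> X (j, i) = X' (j, i)"
  shows "kron_form d k g X = kron_form d k g X'"
  unfolding kron_form_def kron_def
  by (intro sum.cong refl arg_cong2[where f="(*)"] prod.cong) (simp_all add: assms tidx_less)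

lemma sets_gaussian_real [measurable_cong]: "sets gaussian_real = sets borel"
  by (simp add: gaussian_real_def)

lemma measurable_g_law_component:
  "\<alpha> \<in> tidx d k \<Longrightarrow> (\<lambda>g. g \<alpha>) \<in> borel_measurable (g_law d k)"
  unfolding g_law_def by measurable

lemma measurable_factors_law_component:
  assumes "j < k" "i < d"
  shows "(\<lambda>X. X (j, i)) \<in> borel_measurable (factors_law d k t)"
proof -
  have "(\<lambda>X. X (j, i)) \<in> factors_law d k t \<rightarrow>\<^sub>M entry_law (t j)"
    unfolding factors_law_eq
    using assms measurable_component_singleton[of "(j, i)" "{0..<k} \<times> {0..<d}" "\<lambda>p. entry_law (t (fst p))"] by simp
  then show ?thesis by (simp cong: measurable_cong_sets)
qed

lemma measurable_copies_law_component:
  assumes "s < l" "j < k" "i < d"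
  shows "(\<lambda>Y. Y (s, j, i)) \<in> borel_measurable (copies_law d k t l)"
proof -
  have "(\<lambda>Y. Y (s, j, i)) \<in> copies_law d k t l \<rightarrow>\<^sub>M entry_law (t j)"
    unfolding copies_law_eq
    using assms measurable_component_singleton[of "(s, j, i)" "{0..<l} \<times> {0..<k} \<times> {0..<d}" "\<lambda>p. entry_law (t (fst (snd p)))"] by simp
  then show ?thesis by (simp cong: measurable_cong_sets)
qed

lemma measurable_kron:
  assumes "\<alpha> \<in> tidx d k" "\<And>j i. j < k \<Longrightarrow> i < d \<Longrightarrow> (\<lambda>\<omega>. X \<omega> (j, i)) \<in> borel_measurable N"
  shows "(\<lambda>\<omega>. kron k (X \<omega>) \<alpha>) \<in> borel_measurable N"
  unfolding kron_def by (intro borel_measurable_prod assms(2)) (auto simp: tidx_less[OF assms(1)])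

text \<open>Measurability of X is asked entry by entry because slices such as
  \<open>\<lambda>(j, i). Y (s, j, i)\<close> need not lie in the space of
  \<open>factors_law\<close>.\<close>

lemma measurable_kron_form_components:
  assumes f: "f \<in> N \<rightarrow>\<^sub>M g_law d k"
    and X: "\<And>j i. j < k \<Longrightarrow> i < d \<Longrightarrow> (\<lambda>\<omega>. X \<omega> (j, i)) \<in> borel_measurable N"
  shows "(\<lambda>\<omega>. kron_form d k (f \<omega>) (X \<omega>)) \<in> borel_measurable N"
  unfolding kron_form_def
  by (intro borel_measurable_sum borel_measurable_times measurable_kron X
      measurable_compose[OF measurable_compose[OF f measurable_g_law_component] borel_measurable_of_real])

lemma measurable_kron_form [measurable (raw)]:
  assumes f: "f \<in> N \<rightarrow>\<^sub>M g_law d k" and X: "X \<in> N \<rightarrow>\<^sub>M factors_law d k t"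
  shows "(\<lambda>\<omega>. kron_form d k (f \<omega>) (X \<omega>)) \<in> borel_measurable N"
  by (intro measurable_kron_form_components f measurable_compose[OF X measurable_factors_law_component])

lemma measurable_kron_form_copy:
  assumes f: "f \<in> N \<rightarrow>\<^sub>M g_law d k" and Y: "Y \<in> N \<rightarrow>\<^sub>M copies_law d k t l" and "s < l"
  shows "(\<lambda>\<omega>. kron_form d k (f \<omega>) (\<lambda>(j, i). Y \<omega> (s, j, i))) \<in> borel_measurable N"
  using \<open>s < l\<close>
  by (auto intro!: measurable_kron_form_components f measurable_compose[OF Y measurable_copies_law_component])

lemma measurable_sum_squares [measurable (raw)]:
  assumes f: "f \<in> N \<rightarrow>\<^sub>M g_law d k"
  shows "(\<lambda>\<omega>. \<Sum>\<alpha>\<in>tidx d k. (f \<omega> \<alpha>)\<^sup>2) \<in> borel_measurable N"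
  by (intro borel_measurable_sum borel_measurable_power measurable_compose[OF f measurable_g_law_component])

lemma prob_space_g_law: "prob_space (g_law d k)"
proof -
  interpret standardized_law gaussian_real by (rule standardized_law_gaussian)
  show ?thesis unfolding g_law_def by (rule prob_space_PiM) (rule prob_space_axioms)
qed

lemma prob_space_factors_law: "prob_space (factors_law d k t)"
  unfolding factors_law_eq by (rule prob_space_PiM) (rule prob_space_entry_law)

lemma prob_space_copies_law: "prob_space (copies_law d k t l)"
  unfolding copies_law_eq by (rule prob_space_PiM) (rule prob_space_entry_law)

section \<open>The conditional fourth moment averaged over g\<close>

text \<open>Extended values allow Tonelli and Markov without prior integrability; finiteness is read
  off later from the bound at a typical g.\<close>

definition form_moment4 :: "nat \<Rightarrow> nat \<Rightarrow> (nat \<Rightarrow> bool) \<Rightarrow> ((nat \<Rightarrow> nat) \<Rightarrow> real) \<Rightarrow> ennreal" where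
  "form_moment4 d k t g = (\<integral>\<^sup>+X. ennreal (cmod (kron_form d k g X) ^ 4) \<partial>factors_law d k t)"

lemma measurable_form_moment4 [measurable]: "form_moment4 d k t \<in> borel_measurable (g_law d k)"
proof -
  interpret prob_space "factors_law d k t" by (rule prob_space_factors_law)
  show ?thesis unfolding form_moment4_def by measurable
qed

lemma nn_integral_form_moment4:
  assumes d: "1 \<le> d"
  shows "(\<integral>\<^sup>+g. form_moment4 d k t g \<partial>g_law d k) \<le> ennreal (6 * ((real d ^ k)\<^sup>2 * (1 + 1 / real d) ^ k))"
proof -
  interpret F: prob_space "factors_law d k t" by (rule prob_space_factors_law)
  interpret G: prob_space "g_law d k" by (rule prob_space_g_law)
  interpret S: standardized_law gaussian_real by (rule standardized_law_gaussian)
  interpret FG: pair_sigma_finite "factors_law d k t" "g_law d k" ..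
  have [measurable]: "(\<lambda>X. kron k X \<alpha>) \<in> borel_measurable (factors_law d k t)" if "\<alpha> \<in> tidx d k" for \<alpha>
    by (intro measurable_kron[OF that] measurable_factors_law_component)
  have "(\<integral>\<^sup>+g. form_moment4 d k t g \<partial>g_law d k) =
      (\<integral>\<^sup>+X. \<integral>\<^sup>+g. ennreal (cmod (kron_form d k g X) ^ 4) \<partial>g_law d k \<partial>factors_law d k t)"
    unfolding form_moment4_def by (rule FG.Fubini') measurable
  also have "\<dots> \<le> (\<integral>\<^sup>+X. ennreal (6 * (\<Sum>\<alpha>\<in>tidx d k. (cmod (kron k X \<alpha>))\<^sup>2)\<^sup>2) \<partial>factors_law d k t)"
    unfolding kron_form_def g_law_def
    by (intro nn_integral_mono S.nn_integral_complex_linear_form_fourth_power) simp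
  also have "\<dots> = 6 * (\<integral>\<^sup>+X. ennreal ((\<Sum>\<alpha>\<in>tidx d k. (cmod (kron k X \<alpha>))\<^sup>2)\<^sup>2) \<partial>factors_law d k t)"
    by (simp add: ennreal_mult nn_integral_cmult)
  also have "\<dots> \<le> 6 * ennreal ((real d ^ k)\<^sup>2 * (1 + 1 / real d) ^ k)"
    by (intro mult_left_mono nn_integral_kron_norm_fourth_power d) simp
  finally show ?thesis by (simp add: ennreal_mult)
qed

section \<open>Lower bound on the trace and the typical event\<close>

text \<open>The density is at most 1 / sqrt (2 pi) \<le> 1/2 and the interval has length
  1/8.\<close>

lemma gaussian_small_ball: "emeasure gaussian_real {-1/16<..<1/16} \<le> ennreal (1 / 16)"
proof -
  have "2 \<le> sqrt (2 * pi)"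
    using pi_ge_two by (intro real_le_rsqrt) simp
  then have "1 / sqrt (2 * pi) \<le> 1 / 2"
    by (intro divide_left_mono) auto
  then have dens: "std_normal_density x \<le> 1 / 2" for x
    using mult_mono[of "1 / sqrt (2 * pi)" "1 / 2" "exp (- x\<^sup>2 / 2)" 1] unfolding std_normal_density_def by simp
  have "emeasure gaussian_real {-1/16<..<1/16} = (\<integral>\<^sup>+x. ennreal (std_normal_density x) * indicator {-1/16<..<1/16} x \<partial>lborel)"
    unfolding gaussian_real_def by (subst emeasure_density) auto
  also have "\<dots> \<le> (\<integral>\<^sup>+x. ennreal (1 / 2) * indicator {-1/16<..<1/16::real} x \<partial>lborel)"
    by (intro nn_integral_mono mult_right_mono ennreal_leI dens) simp
  also have "\<dots> = ennreal (1 / 2) * ennreal (1 / 8)"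
    by (subst nn_integral_cmult_indicator) auto
  also have "\<dots> = ennreal (1 / 16)"
    by (subst ennreal_mult[symmetric]) simp_all
  finally show ?thesis .
qed

text \<open>If the squared norm is small, then at least half of the coordinates lie in the
  interval below; their expected number is at most one sixteenth of the total.\<close>
lemma gaussian_norm_small_ball:
  assumes d: "1 \<le> d"
  shows "emeasure (g_law d k) {g \<in> space (g_law d k). (\<Sum>\<alpha>\<in>tidx d k. (g \<alpha>)\<^sup>2) < real d ^ k / 512} \<le> ennreal (1 / 8)"
proof -
  interpret S: standardized_law gaussian_real by (rule standardized_law_gaussian)
  define D where "D = real d ^ k"
  have D: "D > 0" using d by (simp add: D_def)
  have cardD: "real (card (tidx d k)) = D" by (simp add: card_tidx D_def)
  let ?J = "{-1/16<..<1/16::real}"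
  define N where "N = (\<lambda>g. \<Sum>\<alpha>\<in>tidx d k. indicator ?J (g \<alpha>) :: real)"
  have ind: "(\<lambda>g. indicator ?J (g \<alpha>) :: real) \<in> borel_measurable (g_law d k)"
    "(\<lambda>g. indicator ?J (g \<alpha>) :: ennreal) \<in> borel_measurable (g_law d k)" if "\<alpha> \<in> tidx d k" for \<alpha>
    by (intro measurable_compose[OF measurable_g_law_component[OF that]] borel_measurable_indicator; simp)+
  have [measurable]: "N \<in> borel_measurable (g_law d k)"
    unfolding N_def by (intro borel_measurable_sum ind(1))
  have "(\<integral>\<^sup>+g. ennreal (N g) \<partial>g_law d k) = (\<Sum>\<alpha>\<in>tidx d k. \<integral>\<^sup>+g. indicator ?J (g \<alpha>) \<partial>g_law d k)"
    unfolding N_def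
    by (subst nn_integral_sum[symmetric], erule ind(2)) (simp add: ennreal_indicator flip: sum_ennreal)
  also have "\<dots> = (\<Sum>\<alpha>\<in>tidx d k. emeasure gaussian_real ?J)"
  proof (intro sum.cong refl)
    fix \<alpha> assume \<alpha>: "\<alpha> \<in> tidx d k"
    have "emeasure gaussian_real ?J = (\<integral>\<^sup>+x. indicator ?J x \<partial>distr (g_law d k) gaussian_real (\<lambda>g. g \<alpha>))"
      unfolding g_law_def using \<alpha> by (subst distr_PiM_component) (auto intro: S.prob_space_axioms)
    also have "\<dots> = (\<integral>\<^sup>+g. indicator ?J (g \<alpha>) \<partial>g_law d k)"
      using \<alpha> by (subst nn_integral_distr) (auto intro: measurable_g_law_component cong: measurable_cong_sets)
    finally show "(\<integral>\<^sup>+g. indicator ?J (g \<alpha>) \<partial>g_law d k) = emeasure gaussian_real ?J" ..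
  qed
  also have "\<dots> \<le> (\<Sum>\<alpha>\<in>tidx d k. ennreal (1 / 16))"
    by (intro sum_mono gaussian_small_ball)
  also have "\<dots> = ennreal (D / 16)"
    by (subst sum_ennreal) (auto simp: cardD)
  finally have EN: "(\<integral>\<^sup>+g. ennreal (N g) \<partial>g_law d k) \<le> ennreal (D / 16)" .
  have "{g \<in> space (g_law d k). (\<Sum>\<alpha>\<in>tidx d k. (g \<alpha>)\<^sup>2) < D / 512}
      \<subseteq> {g \<in> space (g_law d k). 1 \<le> ennreal (2 / D) * ennreal (N g)}"
  proof safe
    fix g assume *: "(\<Sum>\<alpha>\<in>tidx d k. (g \<alpha>)\<^sup>2) < D / 512"
    \<comment> \<open>A coordinate outside the interval adds at least (1/16)^2 = 1/256 to the
      squared norm. Below D/512 fewer than D/2 coordinates can lie outside, and Markov with mean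
      D/16 then gives 1/8.\<close>
    have "(1 - indicator ?J x) / 256 \<le> x\<^sup>2" for x :: real
    proof (cases "x \<in> ?J")
      case False
      then have "\<bar>1 / 16\<bar> \<le> \<bar>x\<bar>" by auto
      then have "(1 / 16)\<^sup>2 \<le> x\<^sup>2" by (simp only: abs_le_square_iff)
      then show ?thesis using False by (simp add: power2_eq_square)
    qed simp
    then have "(\<Sum>\<alpha>\<in>tidx d k. (1 - indicator ?J (g \<alpha>)) / 256) \<le> (\<Sum>\<alpha>\<in>tidx d k. (g \<alpha>)\<^sup>2)"
      by (intro sum_mono)
    also have "(\<Sum>\<alpha>\<in>tidx d k. (1 - indicator ?J (g \<alpha>)) / 256) = (D - N g) / 256"
      by (simp add: N_def sum_subtractf cardD flip: sum_divide_distrib)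
    finally have "D / 2 \<le> N g" using * by simp
    then have "1 \<le> 2 / D * N g" using D by (simp add: field_simps)
    moreover have "0 \<le> N g" by (simp add: N_def sum_nonneg)
    ultimately show "1 \<le> ennreal (2 / D) * ennreal (N g)"
      using D by (simp flip: ennreal_mult)
  qed
  then have "emeasure (g_law d k) {g \<in> space (g_law d k). (\<Sum>\<alpha>\<in>tidx d k. (g \<alpha>)\<^sup>2) < D / 512}
      \<le> emeasure (g_law d k) {g \<in> space (g_law d k). 1 \<le> ennreal (2 / D) * ennreal (N g)}"
    by (rule emeasure_mono) measurable
  also have "\<dots> \<le> ennreal (2 / D) * (\<integral>\<^sup>+g. ennreal (N g) * indicator (space (g_law d k)) g \<partial>g_law d k)"
    by (rule nn_integral_Markov_inequality) auto
  also have "\<dots> = ennreal (2 / D) * (\<integral>\<^sup>+g. ennreal (N g) \<partial>g_law d k)"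
    by (intro arg_cong2[where f="(*)"] refl nn_integral_cong) simp
  also have "\<dots> \<le> ennreal (2 / D) * ennreal (D / 16)"
    by (intro mult_left_mono EN) simp
  also have "\<dots> = ennreal (1 / 8)"
    using D by (simp flip: ennreal_mult)
  finally show ?thesis by (simp add: D_def)
qed

text \<open>The constant 48 is eight times the constant of the preceding moment bound, so each of the
  two conditions fails with probability at most 1/8.\<close>
definition typical :: "nat \<Rightarrow> nat \<Rightarrow> (nat \<Rightarrow> bool) \<Rightarrow> ((nat \<Rightarrow> nat) \<Rightarrow> real) \<Rightarrow> bool" where
  "typical d k t g \<longleftrightarrow> form_moment4 d k t g \<le> ennreal (48 * ((real d ^ k)\<^sup>2 * (1 + 1 / real d) ^ k))
     \<and> real d ^ k / 512 \<le> (\<Sum>\<alpha>\<in>tidx d k. (g \<alpha>)\<^sup>2)"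

lemma measurable_typical [measurable]: "Measurable.pred (g_law d k) (typical d k t)"
  unfolding typical_def[abs_def] by measurable

lemma emeasure_not_typical:
  assumes d: "1 \<le> d"
  shows "emeasure (g_law d k) {g \<in> space (g_law d k). \<not> typical d k t g} \<le> ennreal (1 / 4)"
proof -
  define A where "A = (real d ^ k)\<^sup>2 * (1 + 1 / real d) ^ k"
  have A: "A > 0" using d by (simp add: A_def add_pos_nonneg)
  let ?W = "{g \<in> space (g_law d k). 1 \<le> ennreal (1 / (48 * A)) * form_moment4 d k t g}"
  let ?S = "{g \<in> space (g_law d k). (\<Sum>\<alpha>\<in>tidx d k. (g \<alpha>)\<^sup>2) < real d ^ k / 512}"
  have "emeasure (g_law d k) ?W \<le> ennreal (1 / (48 * A)) * (\<integral>\<^sup>+g. form_moment4 d k t g * indicator (space (g_law d k)) g \<partial>g_law d k)"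
    by (rule nn_integral_Markov_inequality) auto
  also have "\<dots> = ennreal (1 / (48 * A)) * (\<integral>\<^sup>+g. form_moment4 d k t g \<partial>g_law d k)"
    by (intro arg_cong2[where f="(*)"] refl nn_integral_cong) simp
  also have "\<dots> \<le> ennreal (1 / (48 * A)) * ennreal (6 * A)"
    using nn_integral_form_moment4[OF d] by (intro mult_left_mono) (simp_all add: A_def)
  also have "\<dots> = ennreal (1 / 8)"
    using A by (simp flip: ennreal_mult)
  finally have W: "emeasure (g_law d k) ?W \<le> ennreal (1 / 8)" .
  \<comment> \<open>Puts the failure of the first condition into the form of Markov's inequality; w
    may be infinite.\<close>
  have "1 \<le> ennreal (1 / (48 * A)) * w" if "\<not> w \<le> ennreal (48 * A)" for w
  proof -
    have "1 = ennreal (1 / (48 * A)) * ennreal (48 * A)"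
      using A by (simp flip: ennreal_mult)
    also have "\<dots> \<le> ennreal (1 / (48 * A)) * w"
      using that by (intro mult_left_mono) auto
    finally show ?thesis .
  qed
  then have "{g \<in> space (g_law d k). \<not> typical d k t g} \<subseteq> ?W \<union> ?S"
    by (auto simp: typical_def A_def)
  then have "emeasure (g_law d k) {g \<in> space (g_law d k). \<not> typical d k t g} \<le> emeasure (g_law d k) (?W \<union> ?S)"
    by (rule emeasure_mono) measurable
  also have "\<dots> \<le> emeasure (g_law d k) ?W + emeasure (g_law d k) ?S"
    by (rule emeasure_subadditive) measurable
  also have "\<dots> \<le> ennreal (1 / 8) + ennreal (1 / 8)"
    by (intro add_mono W gaussian_norm_small_ball d)
  also have "\<dots> = ennreal (1 / 4)"
    by (simp flip: ennreal_plus)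
  finally show ?thesis .
qed

section \<open>Moments of the quadratic form at a given g\<close>

text \<open>Unbiasedness of the estimator: by isotropy of x only the diagonal of g g^T
  survives.\<close>

lemma integral_form_square:
  assumes "g \<in> space (g_law d k)"
  shows "(\<integral>X. (cmod (kron_form d k g X))\<^sup>2 \<partial>factors_law d k t) = (\<Sum>\<alpha>\<in>tidx d k. (g \<alpha>)\<^sup>2)"
proof -
  have "complex_of_real (\<integral>X. (cmod (kron_form d k g X))\<^sup>2 \<partial>factors_law d k t) =
      (\<integral>X. qform (tidx d k) (outer g) (kron k X) \<partial>factors_law d k t)"
    unfolding qform_outer by (rule integral_complex_of_real[symmetric])
  also have "\<dots> = (\<integral>X. (\<Sum>\<alpha>\<in>tidx d k. \<Sum>\<beta>\<in>tidx d k.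
      complex_of_real (outer g \<alpha> \<beta>) * (cnj (kron k X \<alpha>) * kron k X \<beta>)) \<partial>factors_law d k t)"
    by (simp add: qform_def mult_ac)
  also have "\<dots> = (\<Sum>\<alpha>\<in>tidx d k. \<Sum>\<beta>\<in>tidx d k. complex_of_real (outer g \<alpha> \<beta>) * (if \<alpha> = \<beta> then 1 else 0))"
    by (simp add: kron_second_moment)
  also have "\<dots> = complex_of_real (\<Sum>\<alpha>\<in>tidx d k. (g \<alpha>)\<^sup>2)"
    by (simp add: if_distrib[where f="\<lambda>x. _ * x"] outer_def power2_eq_square cong: if_cong)
  finally show ?thesis by (simp only: of_real_eq_iff)
qed

text \<open>The constant is 48 * 512^2, from the two conditions of \<^const>\<open>typical\<close>.\<close>
lemma form_square_moments:
  assumes g: "g \<in> space (g_law d k)" and ty: "typical d k t g"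
  defines "Q \<equiv> \<lambda>X. (cmod (kron_form d k g X))\<^sup>2"
  shows "Q \<in> borel_measurable (factors_law d k t)"
    and "integrable (factors_law d k t) Q"
    and "integrable (factors_law d k t) (\<lambda>X. (Q X)\<^sup>2)"
    and "(\<integral>X. (Q X)\<^sup>2 \<partial>factors_law d k t) \<le> 12582912 * (1 + 1 / real d) ^ k * (\<Sum>\<alpha>\<in>tidx d k. (g \<alpha>)\<^sup>2)\<^sup>2"
proof -
  interpret F: prob_space "factors_law d k t" by (rule prob_space_factors_law)
  define A where "A = (real d ^ k)\<^sup>2 * (1 + 1 / real d) ^ k"
  have A: "A \<ge> 0" by (simp add: A_def)
  show Q [measurable]: "Q \<in> borel_measurable (factors_law d k t)"
    unfolding Q_def using g by measurable
  have eq: "(Q X)\<^sup>2 = cmod (kron_form d k g X) ^ 4" for X by (simp add: Q_def)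
  have le: "(\<integral>\<^sup>+X. ennreal ((Q X)\<^sup>2) \<partial>factors_law d k t) \<le> ennreal (48 * A)"
    using ty by (simp add: typical_def form_moment4_def eq A_def)
  show i2: "integrable (factors_law d k t) (\<lambda>X. (Q X)\<^sup>2)"
    using le by (intro integrableI_bounded) (auto simp: top_unique less_top[symmetric])
  show "integrable (factors_law d k t) Q"
    by (rule F.square_integrable_imp_integrable[OF Q i2])
  have "ennreal (\<integral>X. (Q X)\<^sup>2 \<partial>factors_law d k t) \<le> ennreal (48 * A)"
    using le by (subst (asm) nn_integral_eq_integral[OF i2]) auto
  then have "(\<integral>X. (Q X)\<^sup>2 \<partial>factors_law d k t) \<le> 48 * A"
    using A by (subst (asm) ennreal_le_iff) auto
  also have "\<dots> = (48 * (1 + 1 / real d) ^ k) * (real d ^ k)\<^sup>2"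
    by (simp add: A_def)
  \<comment> \<open>The small-ball condition trades the dimension for the trace, D \<le> 512
    tr(A).\<close>
  also have "\<dots> \<le> (48 * (1 + 1 / real d) ^ k) * (512 * (\<Sum>\<alpha>\<in>tidx d k. (g \<alpha>)\<^sup>2))\<^sup>2"
    using ty by (intro mult_left_mono power_mono) (auto simp: typical_def)
  finally show "(\<integral>X. (Q X)\<^sup>2 \<partial>factors_law d k t) \<le> 12582912 * (1 + 1 / real d) ^ k * (\<Sum>\<alpha>\<in>tidx d k. (g \<alpha>)\<^sup>2)\<^sup>2"
    by (simp add: power_mult_distrib)
qed

text \<open>The second moment replaces the variance. The discarded square of the mean is tr(A)^2,
  which is no larger than the order of the bound itself.\<close>

lemma cvariance_form_le:
  assumes g: "g \<in> space (g_law d k)" and ty: "typical d k t g"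
  shows "cvariance (factors_law d k t) (\<lambda>X. qform (tidx d k) (outer g) (kron k X))
    \<le> 12582912 * (1 + 1 / real d) ^ k * (mtrace (tidx d k) (outer g))\<^sup>2"
proof -
  interpret F: prob_space "factors_law d k t" by (rule prob_space_factors_law)
  let ?Q = "\<lambda>X. (cmod (kron_form d k g X))\<^sup>2"
  note Q = form_square_moments[OF assms]
  have "cvariance (factors_law d k t) (\<lambda>X. qform (tidx d k) (outer g) (kron k X)) = F.variance ?Q"
    unfolding cvariance_def qform_outer integral_complex_of_real
    by (simp only: of_real_diff[symmetric] norm_of_real power2_abs)
  also have "\<dots> = F.expectation (\<lambda>X. (?Q X)\<^sup>2) - (F.expectation ?Q)\<^sup>2"
    by (rule F.variance_eq[OF Q(2,3)])
  also have "\<dots> \<le> F.expectation (\<lambda>X. (?Q X)\<^sup>2)"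
    by simp
  also note Q(4)
  finally show ?thesis by (simp add: mtrace_outer)
qed

section \<open>Independent copies and the deviation of their average\<close>

text \<open>The centred copies are orthogonal, so only the l diagonal terms remain, each a variance
  and hence at most the second moment. The mean m is subtracted inside the sum, once per
  copy.\<close>

lemma (in prob_space) expectation_square_sum_indep_le:
  fixes f :: "nat \<Rightarrow> 'a \<Rightarrow> real"
  assumes indep: "indep_vars (\<lambda>_. borel) f {..<l}"
    and int: "\<And>s. s < l \<Longrightarrow> integrable M (f s)"
    and int2: "\<And>s. s < l \<Longrightarrow> integrable M (\<lambda>\<omega>. (f s \<omega>)\<^sup>2)"
    and mean: "\<And>s. s < l \<Longrightarrow> expectation (f s) = m"
    and v: "\<And>s. s < l \<Longrightarrow> expectation (\<lambda>\<omega>. (f s \<omega>)\<^sup>2) \<le> v"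
  shows "integrable M (\<lambda>\<omega>. (\<Sum>s<l. f s \<omega> - m)\<^sup>2)"
    and "expectation (\<lambda>\<omega>. (\<Sum>s<l. f s \<omega> - m)\<^sup>2) \<le> real l * v"
proof -
  define h where "h = (\<lambda>s \<omega>. f s \<omega> - m)"
  have hint: "integrable M (h s)" "expectation (h s) = 0" if "s < l" for s
    using int[OF that] mean[OF that] by (auto simp: h_def prob_space)
  have indep_h: "indep_vars (\<lambda>_. borel) h {..<l}"
    unfolding h_def by (rule indep_vars_compose2[OF indep]) simp
  have diag: "integrable M (\<lambda>\<omega>. h s \<omega> * h s \<omega>)" "expectation (\<lambda>\<omega>. h s \<omega> * h s \<omega>) \<le> v" if "s < l" for s
  proof -
    have "integrable M (\<lambda>\<omega>. (f s \<omega>)\<^sup>2 - 2 * m * f s \<omega> + m\<^sup>2)"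
      using int[OF that] int2[OF that] by auto
    then show "integrable M (\<lambda>\<omega>. h s \<omega> * h s \<omega>)"
      by (simp add: h_def power2_eq_square algebra_simps)
    have "expectation (\<lambda>\<omega>. h s \<omega> * h s \<omega>) = expectation (\<lambda>\<omega>. (f s \<omega>)\<^sup>2) - m\<^sup>2"
      using variance_eq[OF int[OF that] int2[OF that]] by (simp add: h_def mean[OF that] power2_eq_square)
    then show "expectation (\<lambda>\<omega>. h s \<omega> * h s \<omega>) \<le> v"
      using v[OF that] zero_le_power2[of m] by linarith
  qed
  have off: "integrable M (\<lambda>\<omega>. h s \<omega> * h s' \<omega>)" "expectation (\<lambda>\<omega>. h s \<omega> * h s' \<omega>) = 0"
    if "s < l" "s' < l" "s \<noteq> s'" for s s'
  proof -
    have ind: "indep_vars (\<lambda>_. borel) h {s, s'}"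
      using that by (intro indep_vars_subset[OF indep_h]) auto
    show "integrable M (\<lambda>\<omega>. h s \<omega> * h s' \<omega>)"
      using indep_vars_integrable[OF _ ind] that hint by auto
    show "expectation (\<lambda>\<omega>. h s \<omega> * h s' \<omega>) = 0"
      using indep_vars_lebesgue_integral[OF _ ind] that hint by auto
  qed
  have eq: "(\<Sum>s<l. f s \<omega> - m)\<^sup>2 = (\<Sum>s<l. \<Sum>s'<l. h s \<omega> * h s' \<omega>)" for \<omega>
    by (simp add: h_def power2_eq_square sum_product)
  have all: "integrable M (\<lambda>\<omega>. h s \<omega> * h s' \<omega>)" if "s < l" "s' < l" for s s'
    using that diag(1) off(1) by (cases "s = s'") auto
  show "integrable M (\<lambda>\<omega>. (\<Sum>s<l. f s \<omega> - m)\<^sup>2)"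
    unfolding eq by (intro Bochner_Integration.integrable_sum all) auto
  have "expectation (\<lambda>\<omega>. (\<Sum>s<l. f s \<omega> - m)\<^sup>2) = (\<Sum>s<l. \<Sum>s'<l. expectation (\<lambda>\<omega>. h s \<omega> * h s' \<omega>))"
    unfolding eq
    by (subst Bochner_Integration.integral_sum, (intro Bochner_Integration.integrable_sum all; simp),
        intro sum.cong refl Bochner_Integration.integral_sum all) auto
  also have "\<dots> \<le> (\<Sum>s<l. \<Sum>s'<l. if s = s' then v else 0)"
    using diag(2) off(2) by (intro sum_mono) auto
  finally show "expectation (\<lambda>\<omega>. (\<Sum>s<l. f s \<omega> - m)\<^sup>2) \<le> real l * v"
    by simp
qed

text \<open>Independence means that the joint law is the product of the marginals. Here the joint
  law is the product measure itself, as restricting to I fixes every point of its space.\<close>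

lemma indep_vars_PiM_coordinates:
  assumes I: "I \<noteq> {}" and M: "\<And>i. i \<in> I \<Longrightarrow> prob_space (M i)"
  shows "prob_space.indep_vars (PiM I M) M (\<lambda>i \<omega>. \<omega> i) I"
proof -
  interpret prob_space "PiM I M" by (rule prob_space_PiM[OF M])
  have "distr (PiM I M) (PiM I M) (\<lambda>\<omega>. \<lambda>i\<in>I. \<omega> i) = distr (PiM I M) (PiM I M) (\<lambda>\<omega>. \<omega>)"
    by (intro distr_cong) (auto simp: space_PiM)
  also have "\<dots> = PiM I M" by (rule distr_id)
  also have "\<dots> = PiM I (\<lambda>i. distr (PiM I M) (M i) (\<lambda>\<omega>. \<omega> i))"
    by (intro PiM_cong refl distr_PiM_component[symmetric] M)
  finally show ?thesis
    by (subst indep_vars_iff_distr_eq_PiM'[OF I]) auto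
qed

text \<open>Reindexing along the injection \<open>Pair s\<close>; the law of an entry depends on its
  mode only, not on s.\<close>

lemma distr_copies_law:
  assumes "s < l"
  shows "distr (copies_law d k t l) (factors_law d k t) (\<lambda>Y. \<lambda>p\<in>{0..<k} \<times> {0..<d}. Y (s, p)) = factors_law d k t"
  using distr_PiM_reindex[of "{0..<l} \<times> {0..<k} \<times> {0..<d}" "\<lambda>p. entry_law (t (fst (snd p)))" "Pair s" "{0..<k} \<times> {0..<d}"]
    assms prob_space_entry_law
  unfolding factors_law_eq copies_law_eq by (auto simp: inj_on_def)

lemma kron_form_copy:
  "kron_form d k g (\<lambda>(j, i). Y (s, j, i)) = kron_form d k g (\<lambda>p\<in>{0..<k} \<times> {0..<d}. Y (s, p))"
  by (rule kron_form_cong) auto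

text \<open>The s-th value depends only on the block of entries with first index s, and disjoint
  blocks of independent entries are independent. Positivity of d, k and l makes the index set
  nonempty, as the coordinate criterion requires.\<close>

lemma indep_vars_form_copies:
  assumes g: "g \<in> space (g_law d k)" and pos: "1 \<le> d" "1 \<le> k" "1 \<le> l"
  shows "prob_space.indep_vars (copies_law d k t l) (\<lambda>_. borel)
    (\<lambda>s Y. (cmod (kron_form d k g (\<lambda>(j, i). Y (s, j, i))))\<^sup>2) {..<l}"
proof -
  interpret P: prob_space "copies_law d k t l" by (rule prob_space_copies_law)
  let ?M = "\<lambda>p. entry_law (t (fst (snd p)))"
  let ?K = "\<lambda>s. {s} \<times> {0..<k} \<times> {0..<d}"
  have ind: "P.indep_vars ?M (\<lambda>p Y. Y p) ({0..<l} \<times> {0..<k} \<times> {0..<d})"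
    unfolding copies_law_eq using pos by (intro indep_vars_PiM_coordinates prob_space_entry_law) auto
  have "P.indep_vars (\<lambda>s. PiM (?K s) ?M) (\<lambda>s Y. restrict (\<lambda>p. Y p) (?K s)) {..<l}"
    by (rule P.indep_vars_restrict[OF ind]) (auto simp: disjoint_family_on_def)
  then have "P.indep_vars (\<lambda>_. borel) (\<lambda>s Y. (cmod (kron_form d k g (\<lambda>(j, i). restrict (\<lambda>p. Y p) (?K s) (s, j, i))))\<^sup>2) {..<l}"
  proof (rule P.indep_vars_compose2)
    fix s :: nat
    have "(\<lambda>Y. Y (s, j, i)) \<in> borel_measurable (PiM (?K s) ?M)" if "j < k" "i < d" for j i
      using that measurable_component_singleton[of "(s, j, i)" "?K s" ?M] by (simp cong: measurable_cong_sets)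
    then have "(\<lambda>Y. kron_form d k g (\<lambda>(j, i). Y (s, j, i))) \<in> borel_measurable (PiM (?K s) ?M)"
      using g by (intro measurable_kron_form_components) auto
    then show "(\<lambda>Y. (cmod (kron_form d k g (\<lambda>(j, i). Y (s, j, i))))\<^sup>2) \<in> PiM (?K s) ?M \<rightarrow>\<^sub>M borel"
      by measurable
  qed
  moreover have "kron_form d k g (\<lambda>(j, i). restrict (\<lambda>p. Y p) (?K s) (s, j, i)) = kron_form d k g (\<lambda>(j, i). Y (s, j, i))"
    for s :: nat and Y :: "nat \<times> nat \<times> nat \<Rightarrow> complex"
    by (rule kron_form_cong) simp
  ultimately show ?thesis by (simp only:)
qed

text \<open>Each copy has the law of a single x. The general h covers the square and the fourth
  power of the modulus at once.\<close>

lemma form_copy_moments: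
  fixes h :: "real \<Rightarrow> real"
  assumes g: "g \<in> space (g_law d k)" and s: "s < l" and h [measurable]: "h \<in> borel_measurable borel"
  shows "integrable (copies_law d k t l) (\<lambda>Y. h (cmod (kron_form d k g (\<lambda>(j, i). Y (s, j, i))))) \<longleftrightarrow>
      integrable (factors_law d k t) (\<lambda>X. h (cmod (kron_form d k g X)))"
    and "(\<integral>Y. h (cmod (kron_form d k g (\<lambda>(j, i). Y (s, j, i)))) \<partial>copies_law d k t l) =
      (\<integral>X. h (cmod (kron_form d k g X)) \<partial>factors_law d k t)"
proof -
  let ?\<pi> = "\<lambda>Y. \<lambda>p\<in>{0..<k} \<times> {0..<d}. Y (s, p)"
  have [measurable]: "(\<lambda>X. h (cmod (kron_form d k g X))) \<in> borel_measurable (factors_law d k t)"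
    using g by measurable
  have [measurable]: "?\<pi> \<in> copies_law d k t l \<rightarrow>\<^sub>M factors_law d k t"
    unfolding factors_law_eq
  proof (rule measurable_restrict)
    fix p assume "p \<in> {0..<k} \<times> {0..<d}"
    then show "(\<lambda>Y. Y (s, p)) \<in> copies_law d k t l \<rightarrow>\<^sub>M entry_law (t (fst p))"
      using measurable_copies_law_component[OF s, of "fst p" k "snd p" d t] by (auto cong: measurable_cong_sets)
  qed
  note D = distr_copies_law[OF s, of d k t]
  show "integrable (copies_law d k t l) (\<lambda>Y. h (cmod (kron_form d k g (\<lambda>(j, i). Y (s, j, i))))) \<longleftrightarrow>
      integrable (factors_law d k t) (\<lambda>X. h (cmod (kron_form d k g X)))"
    using integrable_distr_eq[of ?\<pi> "copies_law d k t l" "factors_law d k t" "\<lambda>X. h (cmod (kron_form d k g X))"]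
    unfolding kron_form_copy D by simp
  show "(\<integral>Y. h (cmod (kron_form d k g (\<lambda>(j, i). Y (s, j, i)))) \<partial>copies_law d k t l) =
      (\<integral>X. h (cmod (kron_form d k g X)) \<partial>factors_law d k t)"
    using integral_distr[of ?\<pi> "copies_law d k t l" "factors_law d k t" "\<lambda>X. h (cmod (kron_form d k g X))"]
    unfolding kron_form_copy D by simp
qed

lemma hutchinson_outer:
  assumes "1 \<le> l"
  shows "cmod (hutchinson d k l (outer g) Y - complex_of_real m) =
    \<bar>\<Sum>s<l. (cmod (kron_form d k g (\<lambda>(j, i). Y (s, j, i))))\<^sup>2 - m\<bar> / real l"
proof -
  have "hutchinson d k l (outer g) Y - complex_of_real m =
    complex_of_real ((\<Sum>s<l. (cmod (kron_form d k g (\<lambda>(j, i). Y (s, j, i))))\<^sup>2 - m) / real l)"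
    using assms unfolding hutchinson_def qform_outer by (simp add: sum_subtractf field_simps)
  then show ?thesis by (simp only: norm_of_real abs_divide abs_of_nat)
qed

text \<open>The constant is 12 times the one in the variance bound, so that Chebyshev's inequality
  leaves a failure probability of 1/12 and 1/4 + 1/12 = 1/3.\<close>
lemma hutchinson_tail_bound:
  assumes g: "g \<in> space (g_law d k)" and ty: "typical d k t g"
    and pos: "1 \<le> d" "1 \<le> k" "0 < \<epsilon>"
    and l: "real l \<ge> 150994944 * \<epsilon> powr (-2) * (1 + 1 / real d) ^ k"
  shows "measure (copies_law d k t l) {Y \<in> space (copies_law d k t l).
      \<not> cmod (hutchinson d k l (outer g) Y - complex_of_real (mtrace (tidx d k) (outer g)))
        \<le> \<epsilon> * mtrace (tidx d k) (outer g)} \<le> 1 / 12"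
proof -
  interpret P: prob_space "copies_law d k t l" by (rule prob_space_copies_law)
  define m where "m = mtrace (tidx d k) (outer g)"
  define r where "r = (1 + 1 / real d) ^ k"
  define f where "f = (\<lambda>(s::nat) Y. (cmod (kron_form d k g (\<lambda>(j, i). Y (s, j, i))))\<^sup>2)"
  define v where "v = 12582912 * r * m\<^sup>2"
  have r: "r > 0" by (simp add: r_def add_pos_nonneg)
  have "real d ^ k > 0" using pos by simp
  moreover have "real d ^ k / 512 \<le> m" using ty unfolding m_def mtrace_outer typical_def by blast
  ultimately have m: "m > 0" by linarith
  have l': "real l \<ge> 150994944 * r / \<epsilon>\<^sup>2"
    using l pos by (simp add: r_def powr_minus field_simps)
  \<comment> \<open>A positive lower bound excludes l = 0, for which the average would be a division
    by zero.\<close>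
  moreover have "150994944 * r / \<epsilon>\<^sup>2 > 0" using r pos by simp
  ultimately have l1: "1 \<le> l" by (cases l) auto
  note Q = form_square_moments[OF g ty]
  have int: "integrable (copies_law d k t l) (f s)" if "s < l" for s
    unfolding f_def using form_copy_moments(1)[OF g that, of "\<lambda>x. x\<^sup>2"] Q(2) by simp
  have int2: "integrable (copies_law d k t l) (\<lambda>Y. (f s Y)\<^sup>2)" if "s < l" for s
    unfolding f_def using form_copy_moments(1)[OF g that, of "\<lambda>x. (x\<^sup>2)\<^sup>2"] Q(3) by simp
  have mean: "P.expectation (f s) = m" if "s < l" for s
    unfolding f_def m_def using form_copy_moments(2)[OF g that, of "\<lambda>x. x\<^sup>2"] integral_form_square[OF g]
    by (simp add: mtrace_outer)
  have v: "P.expectation (\<lambda>Y. (f s Y)\<^sup>2) \<le> v" if "s < l" for s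
    unfolding f_def v_def m_def r_def mtrace_outer
    using form_copy_moments(2)[OF g that, of "\<lambda>x. (x\<^sup>2)\<^sup>2"] Q(4) by simp
  have indep: "P.indep_vars (\<lambda>_. borel) f {..<l}"
    unfolding f_def by (rule indep_vars_form_copies[OF g pos(1,2) l1])
  note S = P.expectation_square_sum_indep_le[OF indep int int2 mean v]
  \<comment> \<open>The squared Chebyshev threshold for the unnormalised sum; it is positive because
    a typical g has positive trace.\<close>
  define c where "c = (real l * \<epsilon> * m)\<^sup>2"
  have c: "c > 0" using l1 pos m by (simp add: c_def)
  have "measure (copies_law d k t l) {Y \<in> space (copies_law d k t l).
      \<not> cmod (hutchinson d k l (outer g) Y - complex_of_real m) \<le> \<epsilon> * m}
    \<le> measure (copies_law d k t l) {Y \<in> space (copies_law d k t l). c \<le> (\<Sum>s<l. f s Y - m)\<^sup>2}"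
  proof (rule P.finite_measure_mono)
    show "{Y \<in> space (copies_law d k t l). \<not> cmod (hutchinson d k l (outer g) Y - complex_of_real m) \<le> \<epsilon> * m}
      \<subseteq> {Y \<in> space (copies_law d k t l). c \<le> (\<Sum>s<l. f s Y - m)\<^sup>2}"
    proof safe
      fix Y assume "\<not> cmod (hutchinson d k l (outer g) Y - complex_of_real m) \<le> \<epsilon> * m"
      then have "real l * \<epsilon> * m \<le> \<bar>\<Sum>s<l. f s Y - m\<bar>"
        using l1 unfolding hutchinson_outer[OF l1] f_def by (simp add: field_simps)
      then have "(real l * \<epsilon> * m)\<^sup>2 \<le> \<bar>\<Sum>s<l. f s Y - m\<bar>\<^sup>2"
        using pos m by (intro power_mono) auto
      then show "c \<le> (\<Sum>s<l. f s Y - m)\<^sup>2" by (simp add: c_def)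
    qed
    show "{Y \<in> space (copies_law d k t l). c \<le> (\<Sum>s<l. f s Y - m)\<^sup>2} \<in> P.events"
      using borel_measurable_integrable[OF S(1)] by measurable
  qed
  also have "\<dots> \<le> P.expectation (\<lambda>Y. (\<Sum>s<l. f s Y - m)\<^sup>2) / c"
    by (rule integral_Markov_inequality_measure[where A="{}"]) (use S(1) c in auto)
  also have "\<dots> \<le> real l * v / c"
    using S(2) c by (intro divide_right_mono) auto
  \<comment> \<open>The trace cancels, since both the second moment bound and the threshold scale
    with its square.\<close>
  also have "\<dots> = (12582912 * r / \<epsilon>\<^sup>2) / real l"
    using l1 pos m by (simp add: v_def c_def field_simps power2_eq_square)
  also have "\<dots> \<le> 1 / 12"
    using l' l1 pos by (simp add: field_simps)
  finally show ?thesis by (simp add: m_def)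
qed

section \<open>Both claims from the typical event\<close>

theorem theorem7:
  "\<exists>C::real. C > 0 \<and>
    (\<forall>(d::nat) (k::nat) (t::nat \<Rightarrow> bool). 1 \<le> d \<longrightarrow> 1 \<le> k \<longrightarrow>
      measure (g_law d k)
        {g \<in> space (g_law d k).
           cvariance (factors_law d k t) (\<lambda>X. qform (tidx d k) (outer g) (kron k X))
             \<le> C * (1 + 1 / real d) ^ k * (mtrace (tidx d k) (outer g))\<^sup>2} \<ge> 3 / 4
      \<and>
      (\<forall>(\<epsilon>::real) (l::nat). 0 < \<epsilon> \<longrightarrow> \<epsilon> < 1 \<longrightarrow>
         real l \<ge> C * \<epsilon> powr (-2) * (1 + 1 / real d) ^ k \<longrightarrow>
         measure (g_law d k \<Otimes>\<^sub>M copies_law d k t l)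
           {(g, Y) \<in> space (g_law d k \<Otimes>\<^sub>M copies_law d k t l).
              cmod (hutchinson d k l (outer g) Y - complex_of_real (mtrace (tidx d k) (outer g)))
                \<le> \<epsilon> * mtrace (tidx d k) (outer g)} \<ge> 2 / 3))"
proof (intro exI[of _ 150994944] conjI allI impI)
  fix d k :: nat and t :: "nat \<Rightarrow> bool"
  assume d: "1 \<le> d" and k: "1 \<le> k"
  interpret F: prob_space "factors_law d k t" by (rule prob_space_factors_law)
  interpret G: prob_space "g_law d k" by (rule prob_space_g_law)
  let ?T = "{g \<in> space (g_law d k). \<not> typical d k t g}"
  have T: "emeasure (g_law d k) ?T \<le> ennreal (1 / 4)" by (rule emeasure_not_typical[OF d])
  let ?V = "{g \<in> space (g_law d k).
           cvariance (factors_law d k t) (\<lambda>X. qform (tidx d k) (outer g) (kron k X))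
             \<le> 150994944 * (1 + 1 / real d) ^ k * (mtrace (tidx d k) (outer g))\<^sup>2}"
  have "G.prob ?T \<le> 1 / 4"
    using T by (simp add: G.emeasure_eq_measure)
  moreover have "G.prob {g \<in> space (g_law d k). typical d k t g} = 1 - G.prob ?T"
    by (subst G.prob_compl[symmetric]) (auto intro!: arg_cong[where f=G.prob])
  moreover have "G.prob {g \<in> space (g_law d k). typical d k t g} \<le> G.prob ?V"
  proof (rule G.finite_measure_mono)
    show "{g \<in> space (g_law d k). typical d k t g} \<subseteq> ?V"
    proof safe
      fix g assume "g \<in> space (g_law d k)" "typical d k t g"
      note cvariance_form_le[OF this]
      \<comment> \<open>One constant must serve both claims; the variance bound holds with a twelfth
        of it.\<close>
      also have "12582912 * (1 + 1 / real d) ^ k * (mtrace (tidx d k) (outer g))\<^sup>2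
          \<le> 150994944 * (1 + 1 / real d) ^ k * (mtrace (tidx d k) (outer g))\<^sup>2"
        by (intro mult_right_mono) auto
      finally show "cvariance (factors_law d k t) (\<lambda>X. qform (tidx d k) (outer g) (kron k X))
          \<le> 150994944 * (1 + 1 / real d) ^ k * (mtrace (tidx d k) (outer g))\<^sup>2" .
    qed
    \<comment> \<open>Needed for monotonicity, as a non-measurable set would receive measure
      0.\<close>
    show "?V \<in> sets (g_law d k)"
      unfolding cvariance_def qform_outer mtrace_outer by measurable
  qed
  ultimately show "measure (g_law d k) ?V \<ge> 3 / 4" by linarith

  fix \<epsilon> :: real and l :: nat
  assume \<epsilon>: "0 < \<epsilon>" "\<epsilon> < 1" and l: "real l \<ge> 150994944 * \<epsilon> powr (-2) * (1 + 1 / real d) ^ k"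
  interpret P: prob_space "copies_law d k t l" by (rule prob_space_copies_law)
  interpret GP: pair_prob_space "g_law d k" "copies_law d k t l" ..
  let ?GP = "g_law d k \<Otimes>\<^sub>M copies_law d k t l"
  define ok where "ok = (\<lambda>g Y. cmod (hutchinson d k l (outer g) Y - complex_of_real (mtrace (tidx d k) (outer g)))
                \<le> \<epsilon> * mtrace (tidx d k) (outer g))"
  have [measurable]: "Measurable.pred ?GP (\<lambda>p. ok (fst p) (snd p))"
  proof -
    have [measurable]: "(\<lambda>p. kron_form d k (fst p) (\<lambda>(j, i). snd p (s, j, i))) \<in> borel_measurable ?GP" if "s < l" for s
      using that by (intro measurable_kron_form_copy) auto
    show ?thesis
      unfolding ok_def hutchinson_def qform_outer mtrace_outer by measurable
  qed
  define B where "B = {p \<in> space ?GP. \<not> ok (fst p) (snd p)}"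
  have B: "B \<in> sets ?GP" unfolding B_def by measurable
  have "emeasure ?GP B = (\<integral>\<^sup>+g. emeasure (copies_law d k t l) (Pair g -` B) \<partial>g_law d k)"
    by (rule P.emeasure_pair_measure_alt[OF B])
  \<comment> \<open>The slice of the bad event at g has measure at most 1/12 if g is typical and
    trivially at most 1 otherwise, so the sum of both bounds always suffices and integrates to at
    most 1/4 + 1/12.\<close>
  also have "\<dots> \<le> (\<integral>\<^sup>+g. indicator ?T g + ennreal (1 / 12) \<partial>g_law d k)"
  proof (rule nn_integral_mono)
    fix g assume g: "g \<in> space (g_law d k)"
    show "emeasure (copies_law d k t l) (Pair g -` B) \<le> indicator ?T g + ennreal (1 / 12)"
    proof (cases "typical d k t g")
      case True
      have "Pair g -` B = {Y \<in> space (copies_law d k t l). \<not> ok g Y}"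
        using g by (auto simp: B_def space_pair_measure)
      then have "emeasure (copies_law d k t l) (Pair g -` B) \<le> ennreal (1 / 12)"
        using hutchinson_tail_bound[OF g True d k \<epsilon>(1) l] by (simp add: ok_def P.emeasure_eq_measure)
      then show ?thesis by (simp add: add_increasing)
    next
      case False
      have "emeasure (copies_law d k t l) (Pair g -` B) \<le> 1"
        by (rule P.emeasure_le_1)
      with False g show ?thesis by (simp add: add_increasing2)
    qed
  qed
  also have "\<dots> = emeasure (g_law d k) ?T + ennreal (1 / 12)"
    by (subst nn_integral_add) (auto simp: G.emeasure_space_1)
  also have "\<dots> \<le> ennreal (1 / 4) + ennreal (1 / 12)"
    by (intro add_right_mono T)
  also have "\<dots> = ennreal (1 / 3)"
    by (subst ennreal_plus[symmetric]) simp_all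
  finally have "GP.prob B \<le> 1 / 3"
    by (simp add: GP.emeasure_eq_measure)
  moreover have "GP.prob {p \<in> space ?GP. ok (fst p) (snd p)} = 1 - GP.prob B"
    by (subst GP.prob_compl[OF B, symmetric]) (auto simp: B_def intro!: arg_cong[where f=GP.prob])
  moreover have "{p \<in> space ?GP. ok (fst p) (snd p)} = {(g, Y) \<in> space ?GP.
              cmod (hutchinson d k l (outer g) Y - complex_of_real (mtrace (tidx d k) (outer g)))
                \<le> \<epsilon> * mtrace (tidx d k) (outer g)}"
    by (auto simp: ok_def)
  ultimately show "measure ?GP {(g, Y) \<in> space ?GP.
              cmod (hutchinson d k l (outer g) Y - complex_of_real (mtrace (tidx d k) (outer g)))
                \<le> \<epsilon> * mtrace (tidx d k) (outer g)} \<ge> 2 / 3"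
    by simp
qed simp

end
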